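(* Let $(M^3,g,f,E)$ be an electrostatic system with cosmological constant $\Lambda$, where $M$ is compact without boundary. Suppose that the electric field $E$ and the gradient $\nabla f$ of the lapse function are linearly dependent, i.e. there is a smooth function $\rho$ on $M$ with $E=\rho\nabla f$, and put $Q=2(1-f^2\rho^2)$. Suppose that the Bach tensor $B$ of $g$ is divergence-free in the sense that $\mathrm{div}^2B=\nabla^i\nabla^jB_{ij}=0$ on $M$, and that either $Q>0$ everywhere on $M$ or $Q<0$ everywhere on $M$. Then $(M^3,g)$ is locally conformally flat.
   Context: An electrostatic system with cosmological constant $\Lambda$ (a real constant) is $(M^3,g,f,E)$, where $(M^3,g)$ is a 3-dimensional Riemannian manifold, $E$ is a tangent vector field on $M$ (the electric field) and $f\in C^\infty(M)$ (the lapse function) satisfy $$\nabla^2 f=f(\mathrm{Ric}-\Lambda g+2E^\flat\otimes E^\flat-|E|^2g),\quad \Delta f=(|E|^2-\Lambda)f,\quad \mathrm{div}E=0,\quad \mathrm{curl}(fE)=0,$$ where $E^\flat$ is the one-form metrically dual to $E$, and $\mathrm{curl}(fE)=0$ means $df\wedge E^\flat+f\,dE^\flat=0$. Here $\mathrm{Ric}$, $\nabla^2$, $\mathrm{div}$, $\Delta$ are the Ricci tensor, Hessian, divergence and Laplacian of $g$. It is assumed that $f>0$ on $M$; if $M$ has nonempty boundary, it is assumed that $f^{-1}(0)=\partial M$ and $f>0$ away from $\partial M$. With $R$ the scalar curvature, the Cotton tensor is $C_{ijk}=\nabla_iR_{jk}-\nabla_jR_{ik}-\frac14(\nabla_iR\,g_{jk}-\nabla_jR\,g_{ik})$,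 and the Bach tensor (dimension 3) is $B_{ij}=\nabla^kC_{kij}$. *)

theory Defs
  imports "HOL-Analysis.Analysis"
begin

section \<open>Smooth functions on open subsets of Euclidean space\<close>

text \<open>Only used for open \<open>S\<close>, where differentiability within \<open>S\<close> and at points of \<open>S\<close> agree.\<close>

fun Ck_on :: "nat \<Rightarrow> 'a::euclidean_space set \<Rightarrow> ('a \<Rightarrow> 'b::real_normed_vector) \<Rightarrow> bool" where
  "Ck_on 0 S h \<longleftrightarrow> continuous_on S h"
| "Ck_on (Suc k) S h \<longleftrightarrow>
     h differentiable_on S \<and> (\<forall>b\<in>Basis. Ck_on k S (\<lambda>x. frechet_derivative h (at x) b))"

definition smooth_on :: "'a::euclidean_space set \<Rightarrow> ('a \<Rightarrow> 'b::real_normed_vector) \<Rightarrow> bool" where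
  "smooth_on S h \<longleftrightarrow> (\<forall>k. Ck_on k S h)"


section \<open>Smooth 3-manifolds without boundary\<close>

text \<open>A chart is a domain together with a coordinate map; only the values of the coordinate map on
  the domain matter. All charts are modelled on \<open>real^3\<close>, so there is no boundary.
  Atlases need not be maximal and manifolds need not be connected.\<close>

type_synonym 'a chart = "'a set \<times> ('a \<Rightarrow> real^3)"

abbreviation chart_dom :: "'a chart \<Rightarrow> 'a set" where "chart_dom \<equiv> fst"
abbreviation chart_map :: "'a chart \<Rightarrow> 'a \<Rightarrow> real^3" where "chart_map \<equiv> snd"

definition chart_inv :: "'a chart \<Rightarrow> real^3 \<Rightarrow> 'a" where
  "chart_inv c = inv_into (chart_dom c) (chart_map c)"

definition chart_im :: "'a chart \<Rightarrow> (real^3) set" where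
  "chart_im c = chart_map c ` chart_dom c"

definition transition :: "'a chart \<Rightarrow> 'a chart \<Rightarrow> real^3 \<Rightarrow> real^3" where
  "transition c d = (\<lambda>x. chart_map d (chart_inv c x))"

definition is_chart :: "'a topology \<Rightarrow> 'a chart \<Rightarrow> bool" where
  "is_chart X c \<longleftrightarrow> openin X (chart_dom c) \<and> open (chart_im c) \<and>
     homeomorphic_map (subtopology X (chart_dom c)) (top_of_set (chart_im c)) (chart_map c)"

definition smooth_atlas :: "'a topology \<Rightarrow> 'a chart set \<Rightarrow> bool" where
  "smooth_atlas X A \<longleftrightarrow>
     (\<forall>c\<in>A. is_chart X c) \<and>
     (\<Union>c\<in>A. chart_dom c) = topspace X \<and>
     (\<forall>c\<in>A. \<forall>d\<in>A. smooth_on (chart_map c ` (chart_dom c \<inter> chart_dom d)) (transition c d))"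

definition smooth_manifold3 :: "'a topology \<Rightarrow> 'a chart set \<Rightarrow> bool" where
  "smooth_manifold3 X A \<longleftrightarrow> Hausdorff_space X \<and> second_countable X \<and> smooth_atlas X A"

definition smooth_fun_on :: "'a chart set \<Rightarrow> 'a set \<Rightarrow> ('a \<Rightarrow> real) \<Rightarrow> bool" where
  "smooth_fun_on A V u \<longleftrightarrow>
     (\<forall>c\<in>A. smooth_on (chart_map c ` (chart_dom c \<inter> V)) (\<lambda>x. u (chart_inv c x)))"

text \<open>Tensor fields on the manifold are given by their components in the charts of the atlas,
  as functions of the coordinates, subject to the classical transformation rule.\<close>

type_synonym 'a vector_field = "'a chart \<Rightarrow> real^3 \<Rightarrow> real^3"
type_synonym 'a metric_field = "'a chart \<Rightarrow> real^3 \<Rightarrow> real^3^3"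

definition smooth_vector_field :: "'a chart set \<Rightarrow> 'a vector_field \<Rightarrow> bool" where
  "smooth_vector_field A E \<longleftrightarrow>
     (\<forall>c\<in>A. smooth_on (chart_im c) (E c)) \<and>
     (\<forall>c\<in>A. \<forall>d\<in>A. \<forall>p\<in>chart_dom c \<inter> chart_dom d.
        E d (chart_map d p) =
          jacobian (transition c d) (at (chart_map c p)) *v E c (chart_map c p))"

definition riemannian_metric :: "'a chart set \<Rightarrow> 'a metric_field \<Rightarrow> bool" where
  "riemannian_metric A g \<longleftrightarrow>
     (\<forall>c\<in>A. smooth_on (chart_im c) (g c)) \<and>
     (\<forall>c\<in>A. \<forall>x\<in>chart_im c.
        transpose (g c x) = g c x \<and> (\<forall>v. v \<noteq> 0 \<longrightarrow> v \<bullet> (g c x *v v) > 0)) \<and>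
     (\<forall>c\<in>A. \<forall>d\<in>A. \<forall>p\<in>chart_dom c \<inter> chart_dom d.
        g c (chart_map c p) =
          (let J = jacobian (transition c d) (at (chart_map c p))
           in transpose J ** g d (chart_map d p) ** J))"


section \<open>Tensor calculus in a coordinate chart\<close>

text \<open>Throughout, \<open>G\<close> is the matrix of metric components and \<open>x\<close> the coordinate point.\<close>

definition pd :: "3 \<Rightarrow> (real^3 \<Rightarrow> real) \<Rightarrow> real^3 \<Rightarrow> real" where
  "pd i h x = frechet_derivative h (at x) (axis i 1)"

type_synonym metric_comp = "real^3 \<Rightarrow> real^3^3"

definition ginv :: "metric_comp \<Rightarrow> real^3 \<Rightarrow> 3 \<Rightarrow> 3 \<Rightarrow> real" where
  "ginv G x i j = matrix_inv (G x) $ i $ j"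

text \<open>\<open>christoffel G x k i j\<close> is $\Gamma^k_{ij}$.\<close>

definition christoffel :: "metric_comp \<Rightarrow> real^3 \<Rightarrow> 3 \<Rightarrow> 3 \<Rightarrow> 3 \<Rightarrow> real" where
  "christoffel G x k i j = (1/2) * (\<Sum>l\<in>UNIV. ginv G x k l *
     (pd i (\<lambda>y. G y $ j $ l) x + pd j (\<lambda>y. G y $ i $ l) x - pd l (\<lambda>y. G y $ i $ j) x))"

text \<open>\<open>riem G x l i j k\<close> is the \<open>l\<close>-th component of
  $R(\partial_i,\partial_j)\partial_k =
   \nabla_i\nabla_j\partial_k - \nabla_j\nabla_i\partial_k$; the Ricci tensor is the trace of
  $Y \mapsto R(Y,\partial_j)\partial_k$, so that round spheres have positive Ricci curvature.\<close>

definition riem :: "metric_comp \<Rightarrow> real^3 \<Rightarrow> 3 \<Rightarrow> 3 \<Rightarrow> 3 \<Rightarrow> 3 \<Rightarrow> real" where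
  "riem G x l i j k =
     pd i (\<lambda>y. christoffel G y l j k) x - pd j (\<lambda>y. christoffel G y l i k) x +
     (\<Sum>m\<in>UNIV. christoffel G x l i m * christoffel G x m j k
              - christoffel G x l j m * christoffel G x m i k)"

definition ricci :: "metric_comp \<Rightarrow> real^3 \<Rightarrow> 3 \<Rightarrow> 3 \<Rightarrow> real" where
  "ricci G x j k = (\<Sum>i\<in>UNIV. riem G x i i j k)"

definition scal :: "metric_comp \<Rightarrow> real^3 \<Rightarrow> real" where
  "scal G x = (\<Sum>i\<in>UNIV. \<Sum>j\<in>UNIV. ginv G x i j * ricci G x i j)"

definition grad :: "metric_comp \<Rightarrow> (real^3 \<Rightarrow> real) \<Rightarrow> real^3 \<Rightarrow> real^3" where
  "grad G h x = (\<chi> i. \<Sum>j\<in>UNIV. ginv G x i j * pd j h x)"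

definition hess :: "metric_comp \<Rightarrow> (real^3 \<Rightarrow> real) \<Rightarrow> real^3 \<Rightarrow> 3 \<Rightarrow> 3 \<Rightarrow> real" where
  "hess G h x i j = pd i (pd j h) x - (\<Sum>k\<in>UNIV. christoffel G x k i j * pd k h x)"

definition laplacian :: "metric_comp \<Rightarrow> (real^3 \<Rightarrow> real) \<Rightarrow> real^3 \<Rightarrow> real" where
  "laplacian G h x = (\<Sum>i\<in>UNIV. \<Sum>j\<in>UNIV. ginv G x i j * hess G h x i j)"

definition divergence :: "metric_comp \<Rightarrow> (real^3 \<Rightarrow> real^3) \<Rightarrow> real^3 \<Rightarrow> real" where
  "divergence G V x = (\<Sum>i\<in>UNIV. pd i (\<lambda>y. V y $ i) x +
     (\<Sum>j\<in>UNIV. christoffel G x i i j * V x $ j))"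

definition normsq :: "metric_comp \<Rightarrow> (real^3 \<Rightarrow> real^3) \<Rightarrow> real^3 \<Rightarrow> real" where
  "normsq G V x = (\<Sum>i\<in>UNIV. \<Sum>j\<in>UNIV. G x $ i $ j * V x $ i * V x $ j)"

text \<open>The metric dual one-form $V^\flat$.\<close>

definition dual_form :: "metric_comp \<Rightarrow> (real^3 \<Rightarrow> real^3) \<Rightarrow> real^3 \<Rightarrow> 3 \<Rightarrow> real" where
  "dual_form G V x i = (\<Sum>j\<in>UNIV. G x $ i $ j * V x $ j)"

definition ext_deriv1 :: "(real^3 \<Rightarrow> 3 \<Rightarrow> real) \<Rightarrow> real^3 \<Rightarrow> 3 \<Rightarrow> 3 \<Rightarrow> real" where
  "ext_deriv1 w x i j = pd i (\<lambda>y. w y j) x - pd j (\<lambda>y. w y i) x"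

text \<open>Components of $\mathrm{curl}(hV) = dh\wedge V^\flat + h\,dV^\flat$.\<close>

definition curl_scaled ::
  "metric_comp \<Rightarrow> (real^3 \<Rightarrow> real) \<Rightarrow> (real^3 \<Rightarrow> real^3) \<Rightarrow> real^3 \<Rightarrow> 3 \<Rightarrow> 3 \<Rightarrow> real" where
  "curl_scaled G h V x i j =
     (pd i h x * dual_form G V x j - pd j h x * dual_form G V x i) +
     h x * ext_deriv1 (dual_form G V) x i j"

text \<open>Covariant derivatives of covariant 2- and 3-tensors; the index of differentiation comes
  first: \<open>cov2 G T x i j k\<close> is $\nabla_i T_{jk}$.\<close>

definition cov2 ::
  "metric_comp \<Rightarrow> (real^3 \<Rightarrow> 3 \<Rightarrow> 3 \<Rightarrow> real) \<Rightarrow> real^3 \<Rightarrow> 3 \<Rightarrow> 3 \<Rightarrow> 3 \<Rightarrow> real" where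
  "cov2 G T x i j k = pd i (\<lambda>y. T y j k) x -
     (\<Sum>m\<in>UNIV. christoffel G x m i j * T x m k + christoffel G x m i k * T x j m)"

definition cov3 ::
  "metric_comp \<Rightarrow> (real^3 \<Rightarrow> 3 \<Rightarrow> 3 \<Rightarrow> 3 \<Rightarrow> real) \<Rightarrow> real^3 \<Rightarrow> 3 \<Rightarrow> 3 \<Rightarrow> 3 \<Rightarrow> 3 \<Rightarrow> real" where
  "cov3 G T x i j k l = pd i (\<lambda>y. T y j k l) x -
     (\<Sum>m\<in>UNIV. christoffel G x m i j * T x m k l + christoffel G x m i k * T x j m l
              + christoffel G x m i l * T x j k m)"

definition cotton :: "metric_comp \<Rightarrow> real^3 \<Rightarrow> 3 \<Rightarrow> 3 \<Rightarrow> 3 \<Rightarrow> real" where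
  "cotton G x i j k = cov2 G (ricci G) x i j k - cov2 G (ricci G) x j i k -
     (1/4) * (pd i (scal G) x * G x $ j $ k - pd j (scal G) x * G x $ i $ k)"

text \<open>$B_{ij} = \nabla^k C_{kij}$.\<close>

definition bach :: "metric_comp \<Rightarrow> real^3 \<Rightarrow> 3 \<Rightarrow> 3 \<Rightarrow> real" where
  "bach G x i j = (\<Sum>k\<in>UNIV. \<Sum>l\<in>UNIV. ginv G x k l * cov3 G (cotton G) x l k i j)"

text \<open>$\mathrm{div}^2 T = \nabla^i\nabla^j T_{ij} = g^{ia} g^{jb}\,\nabla_a\nabla_b T_{ij}$.\<close>

definition div2 :: "metric_comp \<Rightarrow> (real^3 \<Rightarrow> 3 \<Rightarrow> 3 \<Rightarrow> real) \<Rightarrow> real^3 \<Rightarrow> real" where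
  "div2 G T x = (\<Sum>i\<in>UNIV. \<Sum>j\<in>UNIV. \<Sum>a\<in>UNIV. \<Sum>b\<in>UNIV.
     ginv G x i a * ginv G x j b * cov3 G (cov2 G T) x a b i j)"


section \<open>Electrostatic systems and local conformal flatness\<close>

text \<open>The case of empty boundary, in which the lapse function is positive everywhere.\<close>

definition electrostatic_system ::
  "'a topology \<Rightarrow> 'a chart set \<Rightarrow> 'a metric_field \<Rightarrow> ('a \<Rightarrow> real) \<Rightarrow> 'a vector_field \<Rightarrow> real \<Rightarrow> bool"
where
  "electrostatic_system X A g f E \<Lambda> \<longleftrightarrow>
     smooth_manifold3 X A \<and> riemannian_metric A g \<and>
     smooth_fun_on A (topspace X) f \<and> smooth_vector_field A E \<and>
     (\<forall>p\<in>topspace X. f p > 0) \<and>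
     (\<forall>c\<in>A. \<forall>x\<in>chart_im c.
        let G = g c; V = E c; h = (\<lambda>y. f (chart_inv c y)) in
          (\<forall>i j. hess G h x i j =
             h x * (ricci G x i j - \<Lambda> * G x $ i $ j
                    + 2 * dual_form G V x i * dual_form G V x j
                    - normsq G V x * G x $ i $ j)) \<and>
          laplacian G h x = (normsq G V x - \<Lambda>) * h x \<and>
          divergence G V x = 0 \<and>
          (\<forall>i j. curl_scaled G h V x i j = 0))"

text \<open>A metric is flat if its curvature tensor vanishes, and locally conformally flat if every point
  has an open neighbourhood \<open>V\<close> with a smooth function \<open>u\<close> on \<open>V\<close> such that $e^{2u}g$ is flat on
  \<open>V\<close> (A. Besse, Einstein Manifolds, Definition 1.164).\<close>

definition flat_on :: "'a chart set \<Rightarrow> 'a set \<Rightarrow> 'a metric_field \<Rightarrow> bool" where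
  "flat_on A V g \<longleftrightarrow>
     (\<forall>c\<in>A. \<forall>x\<in>chart_map c ` (chart_dom c \<inter> V). \<forall>l i j k. riem (g c) x l i j k = 0)"

definition conformal_metric :: "('a \<Rightarrow> real) \<Rightarrow> 'a metric_field \<Rightarrow> 'a metric_field" where
  "conformal_metric u g = (\<lambda>c x. exp (2 * u (chart_inv c x)) *\<^sub>R g c x)"

definition locally_conformally_flat ::
  "'a topology \<Rightarrow> 'a chart set \<Rightarrow> 'a metric_field \<Rightarrow> bool" where
  "locally_conformally_flat X A g \<longleftrightarrow>
     (\<forall>p\<in>topspace X. \<exists>V u. openin X V \<and> p \<in> V \<and> smooth_fun_on A V u \<and>
        flat_on A V (conformal_metric u g))"

end

theory Submission
  imports Defs
begin

text \<open>At an extremum of \<open>f\<close> the field \<open>E = \<rho> \<nabla>f\<close> vanishes, so the equation for the Laplacian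
  gives \<open>\<Lambda> \<ge> 0\<close> at a maximum and \<open>\<Lambda> \<le> 0\<close> at a minimum. Hence \<open>\<Lambda> = 0\<close> and \<open>f\<close> is
  subharmonic; by the strong maximum principle it is constant on each connected component. Then
  \<open>E\<close>, the Hessian of \<open>f\<close> and therefore the Ricci tensor vanish, and in dimension 3 a Ricci flat
  metric is flat. The proof of the strong maximum principle is Hopf's, with a Gaussian barrier.\<close>

section \<open>Smooth functions\<close>

text \<open>Once \<Lambda> = 0, the Laplacian of f is |E|^2 f, which has a sign because f > 0;
  positivity is used again to cancel f from the Hessian equation and leave Ric = 0. Since \<Lambda>
  is one global constant, a maximum and a minimum over all of M constrain it together, even if they
  lie in different components. The constancy of f, in contrast, is obtained component by component;
  components are closed, hence compact. The maximum principle takes the place of an integration of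
  the Laplacian over M, so that all analysis happens inside a single chart. Two points shape the
  preliminaries. Writing the inverse metric as P P^T supplies an orthonormal frame, which serves
  both the sign of the Laplacian at a maximum and the trace in the flatness argument. And one of the
  antisymmetries of the lowered curvature tensor rests on the symmetry of second partial
  derivatives, here derived from the continuity contained in \<open>Ck_on\<close>.\<close>

lemma Ck_on_cong:
  fixes h h' :: "'a::euclidean_space \<Rightarrow> 'b::real_normed_vector"
  assumes "open S" and "\<And>x. x \<in> S \<Longrightarrow> h x = h' x"
  shows "Ck_on k S h \<longleftrightarrow> Ck_on k S h'"
  using assms(2)
proof (induction k arbitrary: h h')
  case 0
  then show ?case by (auto cong: continuous_on_cong)
next
  case (Suc k)
  have diff: "h differentiable_on S \<longleftrightarrow> h' differentiable_on S"
    unfolding differentiable_on_eq_differentiable_at[OF \<open>open S\<close>]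
  proof (intro ball_cong refl iffI)
    fix x assume x: "x \<in> S"
    show "h' differentiable at x" if "h differentiable at x"
      using that has_derivative_transform_within_open[OF _ \<open>open S\<close> x, of h _ UNIV h']
        Suc.prems unfolding differentiable_def by auto
    show "h differentiable at x" if "h' differentiable at x"
      using that has_derivative_transform_within_open[OF _ \<open>open S\<close> x, of h' _ UNIV h]
        Suc.prems unfolding differentiable_def by auto
  qed
  show ?case
  proof (cases "h differentiable_on S")
    case True
    then have "frechet_derivative h (at x) = frechet_derivative h' (at x)" if "x \<in> S" for x
      using that frechet_derivative_transform_within_open[of h x S h'] Suc.prems \<open>open S\<close>
      by (simp add: differentiable_on_eq_differentiable_at)
    with Suc.IH[of "\<lambda>x. frechet_derivative h (at x) _" "\<lambda>x. frechet_derivative h' (at x) _"] diff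
    show ?thesis by simp
  qed (use diff in simp)
qed

lemma smooth_on_continuous: "smooth_on S h \<Longrightarrow> continuous_on S h"
  unfolding smooth_on_def by (metis Ck_on.simps(1))

lemma smooth_on_differentiable:
  "smooth_on S h \<Longrightarrow> open S \<Longrightarrow> x \<in> S \<Longrightarrow> h differentiable (at x)"
  unfolding smooth_on_def by (metis Ck_on.simps(2) differentiable_on_eq_differentiable_at)

lemma smooth_on_frechet:
  "smooth_on S h \<Longrightarrow> b \<in> Basis \<Longrightarrow> smooth_on S (\<lambda>x. frechet_derivative h (at x) b)"
  unfolding smooth_on_def by (metis Ck_on.simps(2))

text \<open>A fixed linear map commutes with directional derivatives, so the induction carries it
  through every order. With coordinate projections this makes the entries of the matrix-valued
  metric smooth.\<close>

lemma Ck_on_bounded_linear: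
  fixes h :: "'a::euclidean_space \<Rightarrow> 'b::real_normed_vector"
  assumes L: "bounded_linear L" and S: "open S"
  shows "Ck_on k S h \<Longrightarrow> Ck_on k S (\<lambda>x. L (h x))"
proof (induction k arbitrary: h)
  case 0
  then show ?case using bounded_linear.continuous_on[OF L] by simp
next
  case (Suc k)
  have d: "((\<lambda>x. L (h x)) has_derivative (\<lambda>v. L (frechet_derivative h (at x) v))) (at x)"
    if "x \<in> S" for x
    using Suc.prems that S
    by (intro bounded_linear.has_derivative[OF L])
       (simp add: differentiable_on_eq_differentiable_at frechet_derivative_works)
  have "Ck_on k S (\<lambda>x. frechet_derivative (\<lambda>x. L (h x)) (at x) b)" if "b \<in> Basis" for b
  proof (subst Ck_on_cong[OF S])
    show "frechet_derivative (\<lambda>x. L (h x)) (at x) b = L (frechet_derivative h (at x) b)"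
      if "x \<in> S" for x
      using frechet_derivative_at[OF d[OF that]] by metis
    show "Ck_on k S (\<lambda>x. L (frechet_derivative h (at x) b))"
      using Suc.IH[of "\<lambda>x. frechet_derivative h (at x) b"] Suc.prems that by simp
  qed
  moreover have "(\<lambda>x. L (h x)) differentiable_on S"
    unfolding differentiable_on_eq_differentiable_at[OF S] using d differentiableI by blast
  ultimately show ?case by simp
qed

lemma smooth_on_bounded_linear:
  fixes h :: "'a::euclidean_space \<Rightarrow> 'b::real_normed_vector"
  shows "bounded_linear L \<Longrightarrow> open S \<Longrightarrow> smooth_on S h \<Longrightarrow> smooth_on S (\<lambda>x. L (h x))"
  unfolding smooth_on_def using Ck_on_bounded_linear by blast

lemma smooth_on_const: "smooth_on S (\<lambda>x. c)"
proof -
  have "Ck_on k S (\<lambda>x. c)" for k and c :: 'b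
    by (induction k arbitrary: c) simp_all
  then show ?thesis by (simp add: smooth_on_def)
qed

section \<open>Partial derivatives\<close>

lemma pd_eqI: "(u has_derivative D) (at x) \<Longrightarrow> pd i u x = D (axis i 1)"
  unfolding pd_def using frechet_derivative_at by metis

lemma pd_cong_open:
  assumes "open S" "x \<in> S" "\<And>y. y \<in> S \<Longrightarrow> u y = w y" "u differentiable (at x)"
  shows "pd i u x = pd i w x"
  unfolding pd_def using frechet_derivative_transform_within_open[OF assms(4,1,2)] assms(3) by metis

lemma pd_const [simp]: "pd i (\<lambda>x. c) x = 0"
  by (simp add: pd_def)

lemma pd_add:
  assumes "u differentiable (at x)" "w differentiable (at x)"
  shows "pd i (\<lambda>y. u y + w y) x = pd i u x + pd i w x"
  using pd_eqI[OF has_derivative_add[OF assms[unfolded frechet_derivative_works]]]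
  by (simp add: pd_def)

lemma pd_mult:
  assumes "u differentiable (at x)" "w differentiable (at x)"
  shows "pd i (\<lambda>y. u y * w y) x = pd i u x * w x + u x * pd i w x"
  using pd_eqI[OF has_derivative_mult[OF assms[unfolded frechet_derivative_works]]]
  by (simp add: pd_def)

lemma pd_cmult:
  assumes "u differentiable (at x)"
  shows "pd i (\<lambda>y. c * u y) x = c * pd i u x"
  using pd_mult[of "\<lambda>y. c"] assms by simp

lemma pd_sum:
  assumes "\<And>k. k \<in> I \<Longrightarrow> u k differentiable (at x)"
  shows "pd i (\<lambda>y. \<Sum>k\<in>I. u k y) x = (\<Sum>k\<in>I. pd i (u k) x)"
  using pd_eqI[OF has_derivative_sum[of I u "\<lambda>k. frechet_derivative (u k) (at x)" "at x"]]
    assms[unfolded frechet_derivative_works]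
  by (simp add: pd_def)

lemma smooth_on_pd: "smooth_on S u \<Longrightarrow> smooth_on S (pd i u)"
  unfolding pd_def by (rule smooth_on_frechet) (auto simp: axis_in_Basis_iff)

lemma frechet_derivative_pd:
  assumes "u differentiable (at x)"
  shows "frechet_derivative u (at x) v = (\<Sum>i\<in>UNIV. v $ i * pd i u x)"
proof -
  have lin: "linear (frechet_derivative u (at x))"
    using assms linear_frechet_derivative by blast
  have "frechet_derivative u (at x) v = frechet_derivative u (at x) (\<Sum>i\<in>UNIV. v $ i *\<^sub>R axis i 1)"
    using basis_expansion[of v] by (simp add: scalar_mult_eq_scaleR)
  also have "\<dots> = (\<Sum>i\<in>UNIV. v $ i * pd i u x)"
    using lin by (simp add: linear_sum linear_cmul pd_def)
  finally show ?thesis .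
qed

text \<open>Restriction to lines reduces the symmetry of mixed derivatives and the second derivative
  test to one-variable calculus.\<close>

lemma line_derivative:
  assumes "u differentiable (at (x + s *\<^sub>R v))"
  shows "((\<lambda>s. u (x + s *\<^sub>R v)) has_real_derivative (\<Sum>i\<in>UNIV. v $ i * pd i u (x + s *\<^sub>R v))) (at s)"
proof -
  let ?F = "frechet_derivative u (at (x + s *\<^sub>R v))"
  have "(u has_derivative ?F) (at (x + s *\<^sub>R v))"
    using assms frechet_derivative_works by blast
  moreover have "((\<lambda>s. x + s *\<^sub>R v) has_derivative (\<lambda>s. s *\<^sub>R v)) (at s)"
    by (auto intro!: derivative_eq_intros)
  ultimately have "((\<lambda>s. u (x + s *\<^sub>R v)) has_derivative (\<lambda>r. ?F (r *\<^sub>R v))) (at s)"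
    using has_derivative_compose by blast
  moreover have "?F (r *\<^sub>R v) = (\<Sum>i\<in>UNIV. v $ i * pd i u (x + s *\<^sub>R v)) * r" for r
    using frechet_derivative_pd[OF assms, of "r *\<^sub>R v"]
    by (simp add: sum_distrib_left sum_distrib_right mult_ac)
  ultimately show ?thesis
    by (simp add: has_field_derivative_def)
qed

lemma line_derivative_axis:
  assumes "u differentiable (at (x + s *\<^sub>R axis i 1))"
  shows "((\<lambda>s. u (x + s *\<^sub>R axis i 1)) has_real_derivative pd i u (x + s *\<^sub>R axis i 1)) (at s)"
proof -
  have "(\<Sum>k\<in>UNIV. axis i (1::real) $ k * pd k u y) = pd i u y" for y
    by (simp add: axis_def if_distrib[of "\<lambda>a. a * _"] cong: if_cong)
  then show ?thesis using line_derivative[OF assms] by simp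
qed

text \<open>The second difference of \<open>u\<close> over a small parallelogram is \<open>t\<^sup>2\<close> times a value of the
  iterated partial derivative, by two applications of the mean value theorem.\<close>

lemma second_difference:
  assumes t: "0 < t"
    and u: "\<And>s r. 0 \<le> s \<Longrightarrow> s \<le> t \<Longrightarrow> 0 \<le> r \<Longrightarrow> r \<le> t \<Longrightarrow>
              u differentiable (at (x + s *\<^sub>R axis i 1 + r *\<^sub>R axis j 1))"
    and du: "\<And>s r. 0 \<le> s \<Longrightarrow> s \<le> t \<Longrightarrow> 0 \<le> r \<Longrightarrow> r \<le> t \<Longrightarrow>
              pd i u differentiable (at (x + s *\<^sub>R axis i 1 + r *\<^sub>R axis j 1))"
  obtains s r where "0 < s" "s < t" "0 < r" "r < t"
    "u (x + t *\<^sub>R axis i 1 + t *\<^sub>R axis j 1) - u (x + t *\<^sub>R axis i 1)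
       - (u (x + t *\<^sub>R axis j 1) - u x)
     = t\<^sup>2 * pd j (pd i u) (x + s *\<^sub>R axis i 1 + r *\<^sub>R axis j 1)"
proof -
  define \<phi> where "\<phi> s = u ((x + t *\<^sub>R axis j 1) + s *\<^sub>R axis i 1) - u (x + s *\<^sub>R axis i 1)" for s
  have d\<phi>: "(\<phi> has_real_derivative
      pd i u ((x + t *\<^sub>R axis j 1) + s *\<^sub>R axis i 1) - pd i u (x + s *\<^sub>R axis i 1)) (at s)"
    if "0 \<le> s" "s \<le> t" for s
    unfolding \<phi>_def
    using u[of s t] u[of s 0] that t
    by (intro DERIV_diff line_derivative_axis) (simp_all add: ac_simps)
  obtain s where s: "0 < s" "s < t" and 1: "\<phi> t - \<phi> 0 = (t - 0) *
      (pd i u ((x + t *\<^sub>R axis j 1) + s *\<^sub>R axis i 1) - pd i u (x + s *\<^sub>R axis i 1))"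
    using MVT2[OF t d\<phi>] by blast
  define \<psi> where "\<psi> r = pd i u ((x + s *\<^sub>R axis i 1) + r *\<^sub>R axis j 1)" for r
  have "(\<psi> has_real_derivative pd j (pd i u) ((x + s *\<^sub>R axis i 1) + r *\<^sub>R axis j 1)) (at r)"
    if "0 \<le> r" "r \<le> t" for r
    unfolding \<psi>_def using du[of s r] that s by (intro line_derivative_axis) simp
  then obtain r where r: "0 < r" "r < t" and 2: "\<psi> t - \<psi> 0 = (t - 0) *
      pd j (pd i u) ((x + s *\<^sub>R axis i 1) + r *\<^sub>R axis j 1)"
    using MVT2[OF t, of \<psi> "\<lambda>r. pd j (pd i u) ((x + s *\<^sub>R axis i 1) + r *\<^sub>R axis j 1)"] by blast
  have "\<phi> t - \<phi> 0 = t * (\<psi> t - \<psi> 0)"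
    using 1 by (simp add: \<psi>_def ac_simps)
  with 2 have "\<phi> t - \<phi> 0 = t\<^sup>2 * pd j (pd i u) (x + s *\<^sub>R axis i 1 + r *\<^sub>R axis j 1)"
    by (simp add: power2_eq_square)
  with that[OF s r] show ?thesis by (simp add: \<phi>_def algebra_simps)
qed

text \<open>The second difference is symmetric in \<open>i\<close> and \<open>j\<close>, so by
  \<open>second_difference\<close> the two mixed derivatives agree at some pair of points of any
  small parallelogram. By continuity each is there within half the gap of its value at
  \<open>x\<close>, so there is no gap.\<close>

lemma pd_commute:
  assumes S: "open S" "x \<in> S" and u: "smooth_on S u"
  shows "pd i (pd j u) x = pd j (pd i u) x"
proof (rule ccontr)
  assume ne: "pd i (pd j u) x \<noteq> pd j (pd i u) x"
  define \<epsilon> where "\<epsilon> = \<bar>pd i (pd j u) x - pd j (pd i u) x\<bar> / 2"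
  have "\<epsilon> > 0" using ne by (simp add: \<epsilon>_def)
  have cont: "isCont (pd i (pd j u)) x" "isCont (pd j (pd i u)) x"
    using S u by (meson continuous_on_eq_continuous_at smooth_on_continuous smooth_on_pd)+
  obtain d where d: "d > 0" "ball x d \<subseteq> S"
    and near: "\<And>y. dist y x < d \<Longrightarrow> dist (pd i (pd j u) y) (pd i (pd j u) x) < \<epsilon>"
      "\<And>y. dist y x < d \<Longrightarrow> dist (pd j (pd i u) y) (pd j (pd i u) x) < \<epsilon>"
  proof -
    obtain d1 where "d1 > 0" "ball x d1 \<subseteq> S" using S openE by blast
    moreover obtain d2 where "d2 > 0" "\<And>y. dist y x < d2 \<Longrightarrow> dist (pd i (pd j u) y) (pd i (pd j u) x) < \<epsilon>"
      using cont(1) \<open>\<epsilon> > 0\<close> unfolding continuous_at_eps_delta by (metis dist_norm)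
    moreover obtain d3 where "d3 > 0" "\<And>y. dist y x < d3 \<Longrightarrow> dist (pd j (pd i u) y) (pd j (pd i u) x) < \<epsilon>"
      using cont(2) \<open>\<epsilon> > 0\<close> unfolding continuous_at_eps_delta by (metis dist_norm)
    ultimately show ?thesis using that[of "min d1 (min d2 d3)"] by (simp add: subset_iff)
  qed
  \<comment> \<open>Points of the parallelogram have distance at most
    \<open>s + r \<le> 2 * t < d\<close> from \<open>x\<close>.\<close>
  define t where "t = d / 3"
  have t: "t > 0" using d by (simp add: t_def)
  have close: "dist (x + s *\<^sub>R axis i 1 + r *\<^sub>R axis j 1) x < d"
    if "0 \<le> s" "s \<le> t" "0 \<le> r" "r \<le> t" for s r i j
  proof -
    have "norm (s *\<^sub>R axis i 1 + r *\<^sub>R axis j 1 :: real^3) \<le> s + r"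
      using norm_triangle_ineq[of "s *\<^sub>R axis i 1" "r *\<^sub>R axis j (1::real)"] that by simp
    then show ?thesis using that d(1) by (simp add: dist_norm t_def add.assoc)
  qed
  then have inS: "x + s *\<^sub>R axis i 1 + r *\<^sub>R axis j 1 \<in> S"
    if "0 \<le> s" "s \<le> t" "0 \<le> r" "r \<le> t" for s r i j
    using that d(2) by (meson dist_commute_lessI mem_ball subsetD)
  have dif: "u differentiable (at y)" "pd k u differentiable (at y)" if "y \<in> S" for y k
    using that S u smooth_on_differentiable smooth_on_pd by blast+
  define \<Delta> where "\<Delta> = u (x + t *\<^sub>R axis i 1 + t *\<^sub>R axis j 1) - u (x + t *\<^sub>R axis i 1)
       - (u (x + t *\<^sub>R axis j 1) - u x)"
  obtain s r where 1: "0 < s" "s < t" "0 < r" "r < t"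
    "\<Delta> = t\<^sup>2 * pd j (pd i u) (x + s *\<^sub>R axis i 1 + r *\<^sub>R axis j 1)"
    unfolding \<Delta>_def by (rule second_difference[OF t, of u x i j]) (auto intro!: dif inS)
  have \<Delta>_alt: "\<Delta> = u (x + t *\<^sub>R axis j 1 + t *\<^sub>R axis i 1) - u (x + t *\<^sub>R axis j 1)
       - (u (x + t *\<^sub>R axis i 1) - u x)"
    unfolding \<Delta>_def by (simp add: add_ac)
  obtain s' r' where 2: "0 < s'" "s' < t" "0 < r'" "r' < t"
    "\<Delta> = t\<^sup>2 * pd i (pd j u) (x + s' *\<^sub>R axis j 1 + r' *\<^sub>R axis i 1)"
    unfolding \<Delta>_alt by (rule second_difference[OF t, of u x j i]) (auto intro!: dif inS)
  have "pd j (pd i u) (x + s *\<^sub>R axis i 1 + r *\<^sub>R axis j 1)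
      = pd i (pd j u) (x + s' *\<^sub>R axis j 1 + r' *\<^sub>R axis i 1)"
    using 1(5) 2(5) t by simp
  moreover have "dist (pd j (pd i u) (x + s *\<^sub>R axis i 1 + r *\<^sub>R axis j 1)) (pd j (pd i u) x) < \<epsilon>"
    using 1 by (intro near close) auto
  moreover have "dist (pd i (pd j u) (x + s' *\<^sub>R axis j 1 + r' *\<^sub>R axis i 1)) (pd i (pd j u) x) < \<epsilon>"
    using 2 by (intro near close) auto
  ultimately show False
    unfolding \<epsilon>_def dist_real_def by (smt (verit) field_sum_of_halves)
qed

section \<open>Symmetric positive definite matrices of size 3\<close>

text \<open>\<open>P\<close> is the lower triangular Cholesky factor. Each pivot is positive because
  it is the value of the quadratic form at a vector where the squares already split off
  vanish.\<close>

lemma cholesky3: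
  fixes N :: "real^3^3"
  assumes sym: "transpose N = N" and pos: "\<And>v. v \<noteq> 0 \<Longrightarrow> v \<bullet> (N *v v) > 0"
  obtains P :: "3 \<Rightarrow> 3 \<Rightarrow> real" where "\<And>i j. N $ i $ j = (\<Sum>a\<in>UNIV. P i a * P j a)"
proof -
  have s: "N $ i $ j = N $ j $ i" for i j
    using arg_cong[OF sym, of "\<lambda>M. M $ j $ i"] by (simp add: transpose_def)
  have q: "0 < a * (N$1$1 * a + N$1$2 * b + N$1$3 * c) + b * (N$1$2 * a + N$2$2 * b + N$2$3 * c)
             + c * (N$1$3 * a + N$2$3 * b + N$3$3 * c)" if "a \<noteq> 0 \<or> b \<noteq> 0 \<or> c \<noteq> 0" for a b c
  proof -
    have "vector [a, b, c] \<noteq> (0 :: real^3)"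
      using that by (auto simp: vec_eq_iff forall_3)
    from pos[OF this] show ?thesis
      by (simp add: inner_vec_def matrix_vector_mult_def sum_3 s[of 2 1] s[of 3 1] s[of 3 2])
  qed
  define l1 where "l1 = sqrt (N$1$1)"
  have N1: "N$1$1 > 0" using q[of 1 0 0] by simp
  have l1: "l1 > 0" "l1 * l1 = N$1$1" using N1 by (simp_all add: l1_def)
  define m2 m3 where "m2 = N$1$2 / l1" and "m3 = N$1$3 / l1"
  have m: "N$1$2 = l1 * m2" "N$1$3 = l1 * m3" using l1 by (simp_all add: m2_def m3_def)
  have "N$2$2 - m2 * m2 > 0"
  proof -
    \<comment> \<open>Makes the completed square vanish, so that the form at
      \<open>(c, 1, 0)\<close> is the second pivot.\<close>
    define c where "c = - m2 / l1"
    have c: "l1 * c = - m2" using l1 by (simp add: c_def)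
    have "c * (N$1$1 * c + N$1$2) + (N$1$2 * c + N$2$2) = (l1 * c + m2)^2 + (N$2$2 - m2 * m2)"
      unfolding m l1(2)[symmetric] by (simp add: power2_eq_square algebra_simps)
    with q[of c 1 0] show ?thesis by (simp add: c)
  qed
  define l2 where "l2 = sqrt (N$2$2 - m2 * m2)"
  have l2: "l2 > 0" "l2 * l2 = N$2$2 - m2 * m2"
    using \<open>N$2$2 - m2 * m2 > 0\<close> by (simp_all add: l2_def)
  define n3 where "n3 = (N$2$3 - m2 * m3) / l2"
  have n: "N$2$3 = l2 * n3 + m2 * m3" "N$2$2 = l2 * l2 + m2 * m2"
    using l2 by (simp_all add: n3_def)
  \<comment> \<open>Back substitution: at \<open>(a, b, 1)\<close> both completed squares vanish and
    the form is the third pivot.\<close>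
  define b where "b = - n3 / l2"
  define a where "a = - (m3 + m2 * b) / l1"
  have a: "l1 * a = - (m3 + m2 * b)" "l2 * b = - n3"
    using l1 l2 by (simp_all add: a_def b_def)
  have "a * (N$1$1 * a + N$1$2 * b + N$1$3) + b * (N$1$2 * a + N$2$2 * b + N$2$3)
      + (N$1$3 * a + N$2$3 * b + N$3$3) =
      (l1 * a + m2 * b + m3)^2 + (l2 * b + n3)^2 + (N$3$3 - m3 * m3 - n3 * n3)"
    unfolding m n l1(2)[symmetric] by (simp add: power2_eq_square algebra_simps)
  then have "N$3$3 - m3 * m3 - n3 * n3 > 0"
    using q[of a b 1] by (simp add: a)
  define l3 where "l3 = sqrt (N$3$3 - m3 * m3 - n3 * n3)"
  have l3: "N$3$3 = m3 * m3 + n3 * n3 + l3 * l3"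
    using \<open>N$3$3 - m3 * m3 - n3 * n3 > 0\<close> by (simp add: l3_def)
  define P where "P i = (\<lambda>a::3. if i = 1 then (if a = 1 then l1 else 0)
    else if i = 2 then (if a = 1 then m2 else if a = 2 then l2 else 0)
    else (if a = 1 then m3 else if a = 2 then n3 else l3))" for i :: 3
  have "\<forall>i j. N $ i $ j = (\<Sum>a\<in>UNIV. P i a * P j a)"
    unfolding forall_3 sum_3
    by (simp add: P_def s[of 2 1] s[of 3 1] s[of 3 2] m n l3 l1(2)[symmetric] algebra_simps)
  with that show thesis by blast
qed

lemma det_pos_def_nonzero:
  fixes N :: "real^'n^'n"
  assumes pos: "\<And>v. v \<noteq> 0 \<Longrightarrow> v \<bullet> (N *v v) > 0"
  shows "det N \<noteq> 0"
proof -
  have "N *v v \<noteq> 0" if "v \<noteq> 0" for v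
    using pos[OF that] by auto
  then show ?thesis
    by (metis invertible_det_nz invertible_left_inverse matrix_left_invertible_ker)
qed

lemma matrix_inv_mult:
  fixes N :: "real^'n^'n"
  assumes "det N \<noteq> 0"
  shows "N ** matrix_inv N = mat 1" "matrix_inv N ** N = mat 1"
proof -
  have "\<exists>A'. N ** A' = mat 1 \<and> A' ** N = mat 1"
    using assms by (simp add: invertible_det_nz[symmetric] invertible_def)
  from someI_ex[OF this] show "N ** matrix_inv N = mat 1" "matrix_inv N ** N = mat 1"
    by (simp_all add: matrix_inv_def)
qed

text \<open>Exhibits the entries of the inverse as quotients of polynomials in the entries of
  \<open>N\<close>; from this the inverse metric inherits differentiability.\<close>

lemma matrix_inv_cramer:
  fixes N :: "real^'n^'n"
  assumes "det N \<noteq> 0"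
  shows "matrix_inv N $ k $ l =
    det (\<chi> i j. if j = k then axis l 1 $ i else N $ i $ j) / det N"
proof -
  have "N *v (matrix_inv N *v axis l 1) = axis l 1"
    by (simp add: matrix_vector_mul_assoc matrix_inv_mult[OF assms])
  then have "matrix_inv N *v axis l 1 =
      (\<chi> k. det (\<chi> i j. if j = k then axis l 1 $ i else N $ i $ j) / det N)"
    using cramer[OF assms] by blast
  moreover have "(matrix_inv N *v axis l 1) $ k = matrix_inv N $ k $ l"
    by (simp add: matrix_vector_mult_basis column_def)
  ultimately show ?thesis by simp
qed

section \<open>A metric in a chart\<close>

text \<open>What the second derivative test requires. No continuity of second derivatives is asked,
  so the Gaussian barrier satisfies it by direct computation.\<close>

definition twice_diff :: "(real^3) set \<Rightarrow> (real^3 \<Rightarrow> real) \<Rightarrow> bool" where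
  "twice_diff S u \<longleftrightarrow>
     (\<forall>x\<in>S. u differentiable (at x) \<and> (\<forall>j. pd j u differentiable (at x)))"

lemma smooth_on_twice_diff: "smooth_on S u \<Longrightarrow> open S \<Longrightarrow> twice_diff S u"
  unfolding twice_diff_def by (meson smooth_on_differentiable smooth_on_pd)

locale chart_metric =
  fixes S :: "(real^3) set" and G :: metric_comp
  assumes S: "open S"
    and smooth: "smooth_on S G"
    and sym: "x \<in> S \<Longrightarrow> transpose (G x) = G x"
    and pos: "x \<in> S \<Longrightarrow> v \<noteq> 0 \<Longrightarrow> v \<bullet> (G x *v v) > 0"
begin

lemma G_sym: "x \<in> S \<Longrightarrow> G x $ i $ j = G x $ j $ i"
  using arg_cong[OF sym, of x "\<lambda>M. M $ j $ i"] by (simp add: transpose_def)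

lemma G_smooth: "smooth_on S (\<lambda>x. G x $ i $ j)"
  by (rule smooth_on_bounded_linear[OF _ S smooth])
     (intro bounded_linear_intros bounded_linear_compose[OF bounded_linear_vec_nth] bounded_linear_vec_nth)

lemma G_diff: "x \<in> S \<Longrightarrow> (\<lambda>x. G x $ i $ j) differentiable (at x)"
  using G_smooth S smooth_on_differentiable by blast

lemma det_G: "x \<in> S \<Longrightarrow> det (G x) \<noteq> 0"
  using pos det_pos_def_nonzero by blast

lemma G_ginv: "x \<in> S \<Longrightarrow> (\<Sum>k\<in>UNIV. G x $ i $ k * ginv G x k j) = (if i = j then 1 else 0)"
  using arg_cong[OF matrix_inv_mult(1)[OF det_G], of x "\<lambda>M. M $ i $ j"]
  by (simp add: matrix_matrix_mult_def ginv_def mat_def)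

lemma ginv_G: "x \<in> S \<Longrightarrow> (\<Sum>k\<in>UNIV. ginv G x i k * G x $ k $ j) = (if i = j then 1 else 0)"
  using arg_cong[OF matrix_inv_mult(2)[OF det_G], of x "\<lambda>M. M $ i $ j"]
  by (simp add: matrix_matrix_mult_def ginv_def mat_def)

lemma normsq_eq: "normsq G V x = V x \<bullet> (G x *v V x)"
  by (simp add: normsq_def inner_vec_def matrix_vector_mult_def sum_distrib_left mult_ac)

lemma normsq_nonneg: "x \<in> S \<Longrightarrow> normsq G V x \<ge> 0"
  unfolding normsq_eq using pos[of x "V x"] by (cases "V x = 0") auto

lemma ginv_diff:
  assumes x: "x \<in> S"
  shows "(\<lambda>x. ginv G x i j) differentiable (at x)"
proof -
  define D where "D y = det (\<chi> k l. if l = i then axis j 1 $ k else G y $ k $ l)" for y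
  have entry: "(\<lambda>y. if l = i then c else G y $ k $ l) differentiable (at x)" for k l c
    using G_diff[OF x] by (cases "l = i") simp_all
  have D: "D differentiable (at x)"
    unfolding D_def det_3 vec_lambda_beta
    by (intro differentiable_add differentiable_diff differentiable_mult entry)
  have d: "(\<lambda>y. det (G y)) differentiable (at x)"
    unfolding det_3 by (intro differentiable_add differentiable_diff differentiable_mult G_diff x)
  have "(\<lambda>y. D y / det (G y)) differentiable (at x)"
    using differentiable_divide[OF D d det_G[OF x]] .
  then obtain F where "((\<lambda>y. D y / det (G y)) has_derivative F) (at x)"
    unfolding differentiable_def by blast
  then have "((\<lambda>y. ginv G y i j) has_derivative F) (at x)"
    by (rule has_derivative_transform_within_open[OF _ S x])
       (simp add: ginv_def matrix_inv_cramer[OF det_G] D_def)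
  then show ?thesis using differentiable_def by blast
qed

lemma ginv_cont: "continuous_on S (\<lambda>x. ginv G x i j)"
  using ginv_diff S by (meson continuous_at_imp_continuous_on differentiable_imp_continuous_within)

lemma christoffel_diff:
  assumes x: "x \<in> S"
  shows "(\<lambda>x. christoffel G x k i j) differentiable (at x)"
  unfolding christoffel_def
  by (intro differentiable_mult differentiable_const differentiable_sum differentiable_add
      differentiable_diff ginv_diff[OF x] ballI
      smooth_on_differentiable[OF smooth_on_pd[OF G_smooth] S x]) simp

lemma christoffel_cont: "continuous_on S (\<lambda>x. christoffel G x k i j)"
  using christoffel_diff S by (meson continuous_at_imp_continuous_on differentiable_imp_continuous_within)

lemma ginv_sym: 
  assumes x: "x \<in> S"
  shows "transpose (matrix_inv (G x)) = matrix_inv (G x)"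
proof -
  have "transpose (matrix_inv (G x)) ** G x = mat 1"
    by (metis det_G[OF x] matrix_inv_mult(1) matrix_transpose_mul sym[OF x] transpose_mat)
  then show ?thesis
    by (metis det_G[OF x] matrix_inv_mult(1) matrix_mul_assoc matrix_mul_lid matrix_mul_rid)
qed

text \<open>Substituting \<open>v = G x *v w\<close> turns the form of the inverse into that of
  \<open>G x\<close>.\<close>

lemma ginv_pos: 
  assumes x: "x \<in> S" and v: "v \<noteq> 0"
  shows "v \<bullet> (matrix_inv (G x) *v v) > 0"
proof -
  define w where "w = matrix_inv (G x) *v v"
  have "G x *v w = v"
    by (simp add: w_def matrix_vector_mul_assoc matrix_inv_mult[OF det_G[OF x]])
  moreover from this v have "w \<noteq> 0" by auto
  ultimately show ?thesis using pos[OF x, of w] by (simp add: w_def inner_commute)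
qed

text \<open>The columns of \<open>P\<close> form a frame that is orthonormal for \<open>G x\<close>.\<close>

lemma frame:
  assumes x: "x \<in> S"
  obtains P :: "3 \<Rightarrow> 3 \<Rightarrow> real" where "\<And>i j. ginv G x i j = (\<Sum>a\<in>UNIV. P i a * P j a)"
  using cholesky3[of "matrix_inv (G x)"] ginv_sym[OF x] ginv_pos[OF x] unfolding ginv_def by blast

end

section \<open>The maximum principle\<close>

text \<open>On each line through \<open>y\<close> the restriction of \<open>u\<close> has a local
  maximum at parameter 0. A positive second derivative there would make the first derivative
  positive just to the right of 0, and \<open>u\<close> would rise above its maximum.\<close>

lemma max_gradient_hessian:
  assumes u: "twice_diff S u" and r: "r > 0" "ball y r \<subseteq> S"
    and max: "\<And>x. x \<in> ball y r \<Longrightarrow> u x \<le> u y"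
  shows "pd i u y = 0" and "(\<Sum>i\<in>UNIV. \<Sum>j\<in>UNIV. v $ i * v $ j * pd i (pd j u) y) \<le> 0"
proof -
  \<comment> \<open>The \<open>+ 1\<close> admits \<open>v = 0\<close>.\<close>
  define d where "d v = r / (norm v + 1)" for v :: "real^3"
  have d: "d v > 0" for v using r by (simp add: d_def add_nonneg_pos)
  have inb: "y + s *\<^sub>R v \<in> ball y r" if "\<bar>s\<bar> < d v" for s v
  proof -
    have "\<bar>s\<bar> * norm v \<le> \<bar>s\<bar> * (norm v + 1)" by (simp add: mult_left_mono)
    also have "\<dots> < r" using that by (simp add: d_def pos_less_divide_eq add_nonneg_pos)
    finally show ?thesis by (simp add: dist_norm)
  qed
  have diff: "u differentiable (at (y + s *\<^sub>R v))" "pd j u differentiable (at (y + s *\<^sub>R v))"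
    if "\<bar>s\<bar> < d v" for s v j
    using inb[OF that] r u unfolding twice_diff_def by blast+
  define \<psi> where "\<psi> v s = (\<Sum>i\<in>UNIV. v $ i * pd i u (y + s *\<^sub>R v))" for v :: "real^3" and s
  have D: "((\<lambda>s. u (y + s *\<^sub>R v)) has_real_derivative \<psi> v s) (at s)" if "\<bar>s\<bar> < d v" for s v
    unfolding \<psi>_def by (rule line_derivative[OF diff(1)[OF that]])
  have \<psi>0: "\<psi> v 0 = 0" for v
    by (rule DERIV_local_max[OF D d[of v]]) (use d[of v] inb[of _ v] max in auto)
  have "\<psi> (axis i 1) 0 = pd i u y"
    by (simp add: \<psi>_def axis_def if_distrib[of "\<lambda>a. a * _"] cong: if_cong)
  with \<psi>0 show "pd i u y = 0" by simp
  show "(\<Sum>i\<in>UNIV. \<Sum>j\<in>UNIV. v $ i * v $ j * pd i (pd j u) y) \<le> 0" (is "?c \<le> 0")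
  proof (rule ccontr)
    assume "\<not> ?c \<le> 0"
    have "(\<psi> v has_real_derivative
        (\<Sum>j\<in>UNIV. v $ j * (\<Sum>i\<in>UNIV. v $ i * pd i (pd j u) (y + 0 *\<^sub>R v)))) (at 0)"
      unfolding \<psi>_def[abs_def]
      by (intro DERIV_sum DERIV_cmult line_derivative diff(2)) (simp add: d)
    moreover have "(\<Sum>j\<in>UNIV. v $ j * (\<Sum>i\<in>UNIV. v $ i * pd i (pd j u) (y + 0 *\<^sub>R v))) = ?c"
      unfolding sum_distrib_left by (subst sum.swap) (simp add: mult_ac)
    ultimately obtain e where e: "e > 0" "\<And>h. 0 < h \<Longrightarrow> h < e \<Longrightarrow> \<psi> v 0 < \<psi> v (0 + h)"
      using DERIV_pos_inc_right[of "\<psi> v" ?c 0] \<open>\<not> ?c \<le> 0\<close> by auto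
    define t where "t = min e (d v) / 2"
    have t: "0 < t" "t < e" "t < d v" using e(1) d[of v] by (auto simp: t_def min_def)
    have "u (y + 0 *\<^sub>R v) < u (y + t *\<^sub>R v)"
    proof (rule DERIV_pos_imp_increasing_open[OF t(1)])
      show "\<exists>c. ((\<lambda>s. u (y + s *\<^sub>R v)) has_real_derivative c) (at s) \<and> 0 < c" if "0 < s" "s < t" for s
        using D[of s v] e(2)[of s] \<psi>0 that t by auto
      show "continuous_on {0..t} (\<lambda>s. u (y + s *\<^sub>R v))"
        by (rule DERIV_atLeastAtMost_imp_continuous_on) (use D t in force)
    qed
    with max[OF inb, of t v] t show False by simp
  qed
qed

context chart_metric
begin

text \<open>The Christoffel terms drop out with the gradient. Splitting the inverse metric as P P^T
  leaves a sum of second derivatives along the columns of \<open>P\<close>, each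
  nonpositive.\<close>

lemma laplacian_max:
  assumes u: "twice_diff S u" and r: "r > 0" "ball y r \<subseteq> S"
    and max: "\<And>x. x \<in> ball y r \<Longrightarrow> u x \<le> u y"
  shows "laplacian G u y \<le> 0"
proof -
  have "y \<in> S" using r by auto
  then obtain P :: "3 \<Rightarrow> 3 \<Rightarrow> real" where P: "\<And>i j. ginv G y i j = (\<Sum>a\<in>UNIV. P i a * P j a)"
    using frame by blast
  have "laplacian G u y = (\<Sum>i\<in>UNIV. \<Sum>j\<in>UNIV. ginv G y i j * pd i (pd j u) y)"
    using max_gradient_hessian(1)[OF assms] by (simp add: laplacian_def hess_def)
  also have "\<dots> = (\<Sum>a\<in>UNIV. \<Sum>i\<in>UNIV. \<Sum>j\<in>UNIV. P i a * P j a * pd i (pd j u) y)"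
    unfolding P sum_3 by (simp add: algebra_simps)
  also have "\<dots> \<le> 0"
  proof (rule sum_nonpos)
    show "(\<Sum>i\<in>UNIV. \<Sum>j\<in>UNIV. P i a * P j a * pd i (pd j u) y) \<le> 0" for a
      using max_gradient_hessian(2)[OF assms, of "\<chi> i. P i a"] by simp
  qed
  finally show ?thesis .
qed

text \<open>Serves to add a small multiple of the barrier and, with \<open>u = 0\<close> and a
  negative factor, to turn minima into maxima.\<close>

lemma laplacian_add_cmult:
  assumes u: "twice_diff S u" and w: "twice_diff S w"
  shows "twice_diff S (\<lambda>x. u x + c * w x)"
    and "x \<in> S \<Longrightarrow> laplacian G (\<lambda>x. u x + c * w x) x = laplacian G u x + c * laplacian G w x"
proof -
  have d: "u differentiable (at x)" "w differentiable (at x)" "(\<lambda>x. c * w x) differentiable (at x)"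
    "pd j u differentiable (at x)" "pd j w differentiable (at x)" "(\<lambda>x. c * pd j w x) differentiable (at x)"
    if "x \<in> S" for x j
    using that u w unfolding twice_diff_def by auto
  have 1: "pd j (\<lambda>x. u x + c * w x) x = pd j u x + c * pd j w x" if "x \<in> S" for j x
    using d[OF that] by (simp add: pd_add pd_cmult)
  have d2: "pd j (\<lambda>x. u x + c * w x) differentiable (at x)" if "x \<in> S" for j x
  proof -
    have "(\<lambda>x. pd j u x + c * pd j w x) differentiable (at x)"
      using d[OF that] by (intro differentiable_add)
    then obtain F where "((\<lambda>x. pd j u x + c * pd j w x) has_derivative F) (at x)"
      unfolding differentiable_def by blast
    then have "(pd j (\<lambda>x. u x + c * w x) has_derivative F) (at x)"
      by (rule has_derivative_transform_within_open[OF _ S that]) (simp add: 1)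
    then show ?thesis using differentiable_def by blast
  qed
  show "twice_diff S (\<lambda>x. u x + c * w x)"
    unfolding twice_diff_def using d d2 by (simp add: differentiable_add)
  have 2: "pd i (pd j (\<lambda>x. u x + c * w x)) x = pd i (pd j u) x + c * pd i (pd j w) x"
    if "x \<in> S" for i j x
  proof -
    have "pd i (pd j (\<lambda>x. u x + c * w x)) x = pd i (\<lambda>x. pd j u x + c * pd j w x) x"
      by (rule pd_cong_open[OF S that]) (simp_all add: 1 d2 that)
    then show ?thesis using d[OF that] by (simp add: pd_add pd_cmult)
  qed
  show "laplacian G (\<lambda>x. u x + c * w x) x = laplacian G u x + c * laplacian G w x" if "x \<in> S"
    unfolding laplacian_def hess_def
    by (simp add: 1 2 that sum.distrib sum_distrib_left algebra_simps sum_subtractf)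
qed

text \<open>The squared gradient of the exponent contributes the term in
  \<open>\<alpha>\<^sup>2\<close>, its Hessian the term linear in \<open>\<alpha>\<close>. Where the
  inverse metric is positive definite the first is positive off \<open>q\<close>, and for large
  \<open>\<alpha>\<close> it dominates on compact sets that avoid \<open>q\<close>.\<close>

lemma laplacian_gaussian:
  fixes q :: "real^3" and \<alpha> :: real
  defines "w \<equiv> \<lambda>x. exp (- \<alpha> * ((x - q) \<bullet> (x - q)))"
  shows "twice_diff S w"
    and "laplacian G w x = w x * (4 * \<alpha>\<^sup>2 * ((x - q) \<bullet> (matrix_inv (G x) *v (x - q)))
      - 2 * \<alpha> * (\<Sum>i\<in>UNIV. \<Sum>j\<in>UNIV. ginv G x i j *
          ((if i = j then 1 else 0) - (\<Sum>k\<in>UNIV. christoffel G x k i j * (x - q) $ k))))"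
proof -
  have dw: "(w has_derivative (\<lambda>v. - 2 * \<alpha> * ((x - q) \<bullet> v) * w x)) (at x)" for x
    unfolding w_def by (auto intro!: derivative_eq_intros simp: inner_commute algebra_simps)
  have pw: "pd j w = (\<lambda>x. - 2 * \<alpha> * (x - q) $ j * w x)" for j
    using pd_eqI[OF dw] by (auto simp: inner_axis)
  have dc: "((\<lambda>x. (x - q) $ j) has_derivative (\<lambda>v. v $ j)) (at x)" for x and j :: 3
    by (auto intro!: derivative_eq_intros bounded_linear_imp_has_derivative bounded_linear_vec_nth)
  have dpw: "(pd j w has_derivative (\<lambda>v. - 2 * \<alpha> * (v $ j) * w x
      + - 2 * \<alpha> * (x - q) $ j * (- 2 * \<alpha> * ((x - q) \<bullet> v) * w x))) (at x)" for x j
    unfolding pw by (rule derivative_eq_intros dc dw | simp add: algebra_simps)+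
  show "twice_diff S w"
    unfolding twice_diff_def using dw dpw differentiableI by blast
  have ppw: "pd i (pd j w) x = w x * (4 * \<alpha>\<^sup>2 * ((x - q) $ i * (x - q) $ j) - 2 * \<alpha> * (if i = j then 1 else 0))"
    for i j
  proof -
    have ax: "axis i (1::real) $ j = (if i = j then 1 else 0)" by (simp add: axis_def)
    show ?thesis
      unfolding pd_eqI[OF dpw] ax by (simp add: inner_axis power2_eq_square algebra_simps)
  qed
  have quad: "(x - q) \<bullet> (matrix_inv (G x) *v (x - q))
      = (\<Sum>i\<in>UNIV. \<Sum>j\<in>UNIV. ginv G x i j * ((x - q) $ i * (x - q) $ j))"
    unfolding inner_vec_def matrix_vector_mult_def ginv_def
    by (simp add: sum_distrib_left mult_ac)
  show "laplacian G w x = w x * (4 * \<alpha>\<^sup>2 * ((x - q) \<bullet> (matrix_inv (G x) *v (x - q)))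
      - 2 * \<alpha> * (\<Sum>i\<in>UNIV. \<Sum>j\<in>UNIV. ginv G x i j *
          ((if i = j then 1 else 0) - (\<Sum>k\<in>UNIV. christoffel G x k i j * (x - q) $ k))))"
  proof -
    have hess: "hess G w x i j = w x * (4 * \<alpha>\<^sup>2 * ((x - q) $ i * (x - q) $ j) - 2 * \<alpha> *
        ((if i = j then 1 else 0) - (\<Sum>k\<in>UNIV. christoffel G x k i j * (x - q) $ k)))" for i j
    proof -
      have "(\<Sum>k\<in>UNIV. christoffel G x k i j * pd k w x)
          = - 2 * \<alpha> * w x * (\<Sum>k\<in>UNIV. christoffel G x k i j * (x - q) $ k)"
        unfolding pw sum_distrib_left by (intro sum.cong) (simp_all add: mult_ac)
      then show ?thesis unfolding hess_def ppw by (simp add: algebra_simps)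
    qed
    have "(\<Sum>i\<in>UNIV. \<Sum>j\<in>UNIV. g i j * (W * (a * (b i * b j) - e * D i j)))
      = W * (a * (\<Sum>i\<in>UNIV. \<Sum>j\<in>UNIV. g i j * (b i * b j))
             - e * (\<Sum>i\<in>UNIV. \<Sum>j\<in>UNIV. g i j * D i j))"
      for g D :: "3 \<Rightarrow> 3 \<Rightarrow> real" and b W a e
      by (simp add: sum_3 algebra_simps)
    then show ?thesis
      unfolding laplacian_def quad hess .
  qed
qed

text \<open>If \<open>u q < u p\<close>, some point where the maximum is attained is nearest to
  \<open>q\<close>. Adding a small Gaussian that is strictly subharmonic near this contact point
  yields a function with an interior maximum and positive Laplacian, against
  \<open>laplacian_max\<close>. The doubled radius keeps the ball about \<open>q\<close> that
  reaches \<open>p\<close> inside the domain.\<close>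

lemma strong_maximum_principle:
  assumes u: "twice_diff S u" and sub: "\<And>x. x \<in> S \<Longrightarrow> laplacian G u x \<ge> 0"
    and r: "ball p (2 * r) \<subseteq> S"
    and max: "\<And>x. x \<in> ball p (2 * r) \<Longrightarrow> u x \<le> u p"
    and q: "q \<in> ball p r"
  shows "u q = u p"
proof (rule ccontr)
  assume "u q \<noteq> u p"
  have diff: "u differentiable (at x)" if "x \<in> S" for x
    using u that by (simp add: twice_diff_def)
  have cont: "continuous_on S u"
    using diff by (meson continuous_at_imp_continuous_on differentiable_imp_continuous_within)
  define R where "R = dist q p"
  have R: "R < r" using q by (simp add: R_def dist_commute)
  have sub_q: "cball q R \<subseteq> ball p (2 * r)"
  proof
    fix x assume "x \<in> cball q R"
    then show "x \<in> ball p (2 * r)"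
      using dist_triangle[of p x q] R by (simp add: R_def dist_commute)
  qed
  \<comment> \<open>The radius \<open>dist q p\<close> puts \<open>p\<close> into \<open>K\<close>,
    so a nearest point exists.\<close>
  define K where "K = {x \<in> cball q R. u x = u p}"
  have "continuous_on (cball q R) u"
    using cont sub_q r continuous_on_subset by blast
  then have "closed K"
    unfolding K_def by (intro continuous_closed_preimage_constant) auto
  then have "closed K" "p \<in> K"
    by (auto simp: K_def R_def)
  then obtain z where z: "z \<in> K" and nearest: "\<And>x. x \<in> K \<Longrightarrow> dist q z \<le> dist q x"
    using distance_attains_inf[of K q] by blast
  have zu: "u z = u p" and zR: "dist q z \<le> R" using z by (auto simp: K_def)
  have "z \<noteq> q" using zu \<open>u q \<noteq> u p\<close> by auto
  have below: "u x < u p" if "dist q x < dist q z" for x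
  proof -
    have "x \<in> cball q R" using that zR by simp
    moreover have "x \<notin> K" using nearest that by force
    ultimately show ?thesis using max[of x] sub_q by (force simp: K_def)
  qed
  define n where "n = (1/2) *\<^sub>R (z - q)"
  define c where "c = q + n"
  have "2 *\<^sub>R n = z - q" by (simp add: n_def)
  then have cn: "z - c = n" "q = c - n" "z = c + n"
    by (simp_all add: c_def scaleR_2 algebra_simps)
  have n0: "n \<noteq> 0" using \<open>z \<noteq> q\<close> by (simp add: n_def)
  \<comment> \<open>Halving the ball about \<open>q\<close> makes the contact point \<open>z\<close> unique.\<close>
  have touch: "u x < u p" if "norm (x - c) \<le> norm n" "x \<noteq> z" for x
  proof (rule below)
    define y where "y = x - z"
    have xc: "x - c = n + y" and xq: "x - q = 2 *\<^sub>R n + y" and zq: "z - q = 2 *\<^sub>R n"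
      by (simp_all add: y_def cn(2,3) algebra_simps scaleR_2)
    have "(n + y) \<bullet> (n + y) \<le> n \<bullet> n"
      using that(1) unfolding xc norm_le .
    then have "2 * (n \<bullet> y) + y \<bullet> y \<le> 0"
      by (simp add: inner_add_left inner_add_right inner_commute)
    moreover have "y \<bullet> y > 0" using that(2) by (simp add: y_def)
    \<comment> \<open>Doubling the first inequality leaves one spare copy of
      \<open>y \<bullet> y > 0\<close>, whence strictness.\<close>
    ultimately have "4 * (n \<bullet> y) + y \<bullet> y < 0" by linarith
    then have "(2 *\<^sub>R n + y) \<bullet> (2 *\<^sub>R n + y) < (2 *\<^sub>R n) \<bullet> (2 *\<^sub>R n)"
      by (simp add: inner_add_left inner_add_right inner_commute)
    then have "norm (x - q) < norm (z - q)"
      unfolding xq zq norm_lt .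
    then show "dist q x < dist q z"
      by (simp add: dist_norm norm_minus_commute)
  qed
  have "z \<in> ball p (2 * r)" using z sub_q by (auto simp: K_def)
  then obtain s0 where s0: "s0 > 0" "cball z s0 \<subseteq> ball p (2 * r)"
    using open_contains_cball open_ball by blast
  \<comment> \<open>Half of \<open>norm n\<close> keeps the closed ball away from \<open>c\<close>,
    where the term in \<open>\<alpha>\<^sup>2\<close> degenerates.\<close>
  define s where "s = min s0 (norm n / 2)"
  have s: "s > 0" "cball z s \<subseteq> ball p (2 * r)" "s \<le> norm n / 2"
    using s0 n0 by (auto simp: s_def)
  have sS: "cball z s \<subseteq> S" using s r by blast
  have away: "x - c \<noteq> 0" if "x \<in> cball z s" for x
  proof
    assume "x - c = 0"
    then have "dist z x = norm n" by (simp add: dist_norm cn)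
    with that have "norm n \<le> s" by simp
    with s(1,3) show False by linarith
  qed
  define q2 where "q2 x = (x - c) \<bullet> (matrix_inv (G x) *v (x - c))" for x
  have q2_eq: "q2 x = (\<Sum>i\<in>UNIV. \<Sum>j\<in>UNIV. (x - c) $ i * (ginv G x i j * (x - c) $ j))" for x
    by (simp add: q2_def inner_vec_def matrix_vector_mult_def ginv_def sum_distrib_left)
  define q1 where "q1 x = (\<Sum>i\<in>UNIV. \<Sum>j\<in>UNIV. ginv G x i j *
          ((if i = j then 1 else 0) - (\<Sum>k\<in>UNIV. christoffel G x k i j * (x - c) $ k)))" for x
  have cont_ginv: "continuous_on (cball z s) (\<lambda>x. ginv G x i j)"
    and cont_chr: "continuous_on (cball z s) (\<lambda>x. christoffel G x k i j)" for i j k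
    using ginv_cont christoffel_cont sS continuous_on_subset by blast+
  have "continuous_on (cball z s) q2"
    unfolding q2_eq by (intro continuous_intros cont_ginv)
  moreover have "compact (cball z s)" "cball z s \<noteq> {}" using s by auto
  ultimately obtain y where y: "y \<in> cball z s" "\<And>x. x \<in> cball z s \<Longrightarrow> q2 y \<le> q2 x"
    using continuous_attains_inf by metis
  define \<mu> where "\<mu> = q2 y"
  have \<mu>: "\<mu> > 0"
    unfolding \<mu>_def q2_def using y(1) sS away by (intro ginv_pos) auto
  have "continuous_on (cball z s) q1"
    unfolding q1_def[abs_def] by (intro continuous_intros cont_ginv cont_chr)
  then have "bounded (q1 ` cball z s)"
    by (intro compact_imp_bounded compact_continuous_image) auto
  then obtain C where C: "C > 0" "\<And>x. x \<in> cball z s \<Longrightarrow> \<bar>q1 x\<bar> \<le> C"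
    unfolding bounded_pos by auto
  \<comment> \<open>Then the quadratic term is at least \<open>4 * \<alpha> * C\<close>, while the
    linear one is at most \<open>2 * \<alpha> * C\<close>.\<close>
  define \<alpha> where "\<alpha> = C / \<mu>"
  have \<alpha>: "\<alpha> > 0" "\<alpha> * \<mu> = C" using C \<mu> by (simp_all add: \<alpha>_def)
  define w where "w x = exp (- \<alpha> * ((x - c) \<bullet> (x - c)))" for x
  note gauss = laplacian_gaussian[where q = c and \<alpha> = \<alpha>, folded w_def[abs_def] q1_def q2_def]
  have lap_w: "laplacian G w x > 0" if "x \<in> cball z s" for x
  proof -
    have "C \<le> \<alpha> * q2 x"
      using mult_left_mono[OF y(2)[OF that], of \<alpha>] \<alpha> by (simp add: \<mu>_def[symmetric])
    then have "\<alpha> * C \<le> \<alpha>\<^sup>2 * q2 x"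
      using mult_left_mono[of C "\<alpha> * q2 x" \<alpha>] \<alpha> by (simp add: power2_eq_square mult.assoc)
    moreover have "\<alpha> * q1 x \<le> \<alpha> * C"
      using mult_left_mono[OF abs_le_D1[OF C(2)[OF that]], of \<alpha>] \<alpha> by simp
    moreover have "\<alpha> * C > 0" using \<alpha> C by simp
    ultimately have "4 * \<alpha>\<^sup>2 * q2 x - 2 * \<alpha> * q1 x > 0" by linarith
    then show ?thesis
      by (simp add: gauss(2) w_def)
  qed
  have wz: "w z = exp (- \<alpha> * (n \<bullet> n))" by (simp add: w_def cn)
  have w_out: "w x < w z" if "norm (x - c) > norm n" for x
    using that \<alpha> unfolding norm_lt wz by (simp add: w_def)
  \<comment> \<open>The small sphere is split in two: on the compact set \<open>F\<close>, which
    misses \<open>z\<close>, \<open>u\<close> stays below its maximum by a gap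
    \<open>\<delta>\<close>; off \<open>F\<close> the barrier is smaller than at
    \<open>z\<close>.\<close>
  define F where "F = sphere z s \<inter> cball c (norm n)"
  obtain \<delta> where \<delta>: "\<delta> > 0" "\<And>x. x \<in> F \<Longrightarrow> u x \<le> u p - \<delta>"
  proof (cases "F = {}")
    case False
    have "compact F" unfolding F_def by (intro compact_Int_closed) auto
    moreover have "continuous_on F u"
      by (rule continuous_on_subset[OF cont]) (use sS in \<open>auto simp: F_def\<close>)
    ultimately obtain x0 where x0: "x0 \<in> F" "\<And>x. x \<in> F \<Longrightarrow> u x \<le> u x0"
      using False continuous_attains_sup by metis
    have "u x0 < u p"
      using x0(1) s by (intro touch) (auto simp: F_def dist_norm norm_minus_commute)
    with that[of "u p - u x0"] x0(2) show ?thesis by auto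
  qed (use that[of 1] in auto)
  \<comment> \<open>Since \<open>w x \<le> 1\<close>, the barrier can make up at most half of the
    gap.\<close>
  define \<epsilon> where "\<epsilon> = \<delta> / 2"
  have \<epsilon>: "\<epsilon> > 0" using \<delta> by (simp add: \<epsilon>_def)
  define v where "v x = u x + \<epsilon> * w x" for x
  have td: "twice_diff S v" and lap_v: "laplacian G v x = laplacian G u x + \<epsilon> * laplacian G w x"
    if "x \<in> S" for x
    unfolding v_def[abs_def] using laplacian_add_cmult[OF u gauss(1)] that by auto
  have sphere: "v x < v z" if "x \<in> sphere z s" for x
  proof (cases "norm (x - c) \<le> norm n")
    case True
    then have "u x \<le> u p - \<delta>"
      using that by (intro \<delta>) (simp add: F_def dist_norm norm_minus_commute)
    moreover have "w x \<le> 1" "w z > 0" using \<alpha> by (simp_all add: w_def)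
    then have "\<epsilon> * w x \<le> \<epsilon>" "\<epsilon> * w z > 0" using \<epsilon> by (simp_all add: mult_left_le)
    ultimately show ?thesis using zu \<delta>(1) \<epsilon>_def unfolding v_def by linarith
  next
    case False
    have "x \<in> cball z s" using that by simp
    with s(2) have "u x \<le> u p" by (intro max) blast
    moreover have "\<epsilon> * w x < \<epsilon> * w z" using w_out[of x] False \<epsilon> by simp
    ultimately show ?thesis using zu by (simp add: v_def)
  qed
  have zS: "z \<in> S" using sS s by auto
  have "continuous_on (cball z s) v"
    using td[OF zS] sS unfolding twice_diff_def
    by (meson continuous_at_imp_continuous_on differentiable_imp_continuous_within subsetD)
  then obtain y where y: "y \<in> cball z s" "\<And>x. x \<in> cball z s \<Longrightarrow> v x \<le> v y"
    using continuous_attains_sup[of "cball z s" v] s by auto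
  have "y \<notin> sphere z s" using sphere[of y] y(2)[of z] s by auto
  with y(1) have "y \<in> ball z s" by auto
  then obtain e where e: "e > 0" "ball y e \<subseteq> ball z s"
    using open_contains_ball open_ball by blast
  have "laplacian G v y \<le> 0"
    using e sS ball_subset_cball[of z s] y(2)
    by (intro laplacian_max[OF td[OF zS] e(1)]) blast+
  moreover have "y \<in> S" using y(1) sS by blast
  ultimately show False
    using lap_v[of y] sub[of y] lap_w[OF y(1)] \<epsilon> by (smt (verit) mult_pos_pos)
qed

end

section \<open>Curvature in dimension 3\<close>

text \<open>Lets the antisymmetries of the curvature tensor survive contraction with frame vectors,
  which trade places.\<close>

lemma antisym_contraction:
  fixes F :: "'i::finite \<Rightarrow> 'i \<Rightarrow> real"
  assumes "\<And>i j. F i j = - F j i"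
  shows "(\<Sum>i\<in>UNIV. p i * (\<Sum>j\<in>UNIV. q j * F i j)) = - (\<Sum>i\<in>UNIV. q i * (\<Sum>j\<in>UNIV. p j * F i j))"
proof -
  have "(\<Sum>i\<in>UNIV. p i * (\<Sum>j\<in>UNIV. q j * F i j)) = (\<Sum>j\<in>UNIV. \<Sum>i\<in>UNIV. p i * (q j * F i j))"
    unfolding sum_distrib_left by (rule sum.swap)
  also have "\<dots> = (\<Sum>j\<in>UNIV. - (q j * (\<Sum>i\<in>UNIV. p i * F j i)))"
    unfolding sum_distrib_left sum_negf[symmetric]
    by (intro sum.cong refl) (subst assms, simp)
  finally show ?thesis by (simp add: sum_negf)
qed

lemma contraction_swap:
  fixes F :: "'i::finite \<Rightarrow> 'j::finite \<Rightarrow> real"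
  shows "(\<Sum>i\<in>UNIV. p i * (\<Sum>j\<in>UNIV. q j * F i j)) = (\<Sum>j\<in>UNIV. q j * (\<Sum>i\<in>UNIV. p i * F i j))"
  unfolding sum_distrib_left by (subst sum.swap) (simp add: mult_ac)

text \<open>In dimension 3 any two coordinate planes share an axis, so that a tensor with the two
  antisymmetries of the curvature tensor vanishes with its trace.\<close>

lemma curvature_like_trace_free:
  fixes T :: "3 \<Rightarrow> 3 \<Rightarrow> 3 \<Rightarrow> 3 \<Rightarrow> real"
  assumes inner: "\<And>a b c d. T a b c d = - T a c b d"
    and outer: "\<And>a b c d. T a b c d = - T d b c a"
    and trace: "\<And>c d. (\<Sum>a\<in>UNIV. T a a c d) = 0"
  shows "T a b c d = 0"
proof -
  have z1 [simp]: "T a b b d = 0" for a b d using inner[of a b b d] by simp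
  have z2 [simp]: "T a b c a = 0" for a b c using outer[of a b c a] by simp
  have D: "T a a b b = T b b a a" for a b
    using inner[of a a b b] outer[of a b a b] by simp
  \<comment> \<open>For \<open>c \<noteq> d\<close> a single term of the trace survives. For
    \<open>c = d\<close> the traces say that any two of the three sectional curvatures have sum
    zero, so all three vanish.\<close>
  note tr = trace[unfolded sum_3]
  have "\<forall>e c d. T e e c d = 0"
    unfolding forall_3
    using tr[of 1 1] tr[of 1 2] tr[of 1 3] tr[of 2 1] tr[of 2 2] tr[of 2 3]
      tr[of 3 1] tr[of 3 2] tr[of 3 3] D[of 1 2] D[of 1 3] D[of 2 3]
    by simp
  then have Z [simp]: "T e e c d = 0" for e c d by blast
  \<comment> \<open>Pigeonhole: four indices take only three values.\<close>
  consider "b = a" | "c = a" | "b = d" | "c = d" | "b = c" | "a = d"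
    using exhaust_3[of a] exhaust_3[of b] exhaust_3[of c] exhaust_3[of d] by metis
  then show ?thesis
  proof cases
    case 2 then show ?thesis using inner[of a b c d] by simp
  next
    case 3 then show ?thesis using outer[of a b c d] by simp
  next
    case 4 then show ?thesis using outer[of a b c d] inner[of d b c a] by simp
  qed simp_all
qed

section \<open>Metric compatibility, curvature symmetries and Ricci flatness\<close>

context chart_metric
begin

lemma pd_G_sym: "x \<in> S \<Longrightarrow> pd l (\<lambda>y. G y $ i $ j) x = pd l (\<lambda>y. G y $ j $ i) x"
  by (rule pd_cong_open[OF S]) (simp_all add: G_sym[of _ i j] G_diff)

lemma christoffel_lower:
  assumes x: "x \<in> S"
  shows "(\<Sum>k\<in>UNIV. G x $ m $ k * christoffel G x k i j) = (1/2) *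
     (pd i (\<lambda>y. G y $ j $ m) x + pd j (\<lambda>y. G y $ i $ m) x - pd m (\<lambda>y. G y $ i $ j) x)"
proof -
  define B where "B l = pd i (\<lambda>y. G y $ j $ l) x + pd j (\<lambda>y. G y $ i $ l) x - pd l (\<lambda>y. G y $ i $ j) x"
    for l
  have "(\<Sum>k\<in>UNIV. G x $ m $ k * christoffel G x k i j)
      = (1/2) * (\<Sum>l\<in>UNIV. (\<Sum>k\<in>UNIV. G x $ m $ k * ginv G x k l) * B l)"
    unfolding christoffel_def B_def[symmetric] by (simp add: sum_3 algebra_simps)
  also have "\<dots> = (1/2) * B m"
    unfolding G_ginv[OF x] by (simp add: if_distrib[of "\<lambda>a. a * _"] cong: if_cong)
  finally show ?thesis unfolding B_def .
qed

lemma metric_compatible: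
  assumes x: "x \<in> S"
  shows "pd i (\<lambda>y. G y $ j $ k) x =
    (\<Sum>m\<in>UNIV. G x $ j $ m * christoffel G x m i k + G x $ k $ m * christoffel G x m i j)"
  unfolding sum.distrib christoffel_lower[OF x]
  using pd_G_sym[OF x, of i j k] pd_G_sym[OF x, of j i k] pd_G_sym[OF x, of k i j]
  by (simp add: field_simps)

text \<open>Second partial derivatives of the metric commute. When \<open>metric_compatible\<close>
  is used to rewrite them, their commutator becomes the sum of the two lowered curvature terms,
  which is therefore zero.\<close>

lemma riem_metric_antisym:
  assumes x: "x \<in> S"
  shows "(\<Sum>m\<in>UNIV. G x $ l $ m * riem G x m i j k) = - (\<Sum>m\<in>UNIV. G x $ k $ m * riem G x m i j l)"
proof -
  have pp: "pd i (pd j (\<lambda>y. G y $ k $ l)) x =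
    (\<Sum>m\<in>UNIV. pd i (\<lambda>y. G y $ k $ m) x * christoffel G x m j l
            + G x $ k $ m * pd i (\<lambda>y. christoffel G y m j l) x
            + (pd i (\<lambda>y. G y $ l $ m) x * christoffel G x m j k
            + G x $ l $ m * pd i (\<lambda>y. christoffel G y m j k) x))" for i j
  proof -
    have "pd i (pd j (\<lambda>y. G y $ k $ l)) x = pd i (\<lambda>x.
      \<Sum>m\<in>UNIV. G x $ k $ m * christoffel G x m j l + G x $ l $ m * christoffel G x m j k) x"
      by (rule pd_cong_open[OF S x])
         (auto intro: metric_compatible smooth_on_differentiable[OF smooth_on_pd[OF G_smooth] S x])
    then show ?thesis
      using G_diff[OF x] christoffel_diff[OF x] by (simp add: pd_sum pd_add pd_mult)
  qed
  have "pd i (pd j (\<lambda>y. G y $ k $ l)) x - pd j (pd i (\<lambda>y. G y $ k $ l)) x = 0"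
    using pd_commute[OF S x G_smooth] by simp
  then show ?thesis
    unfolding pp metric_compatible[OF x] riem_def
    using G_sym[OF x, of 2 1] G_sym[OF x, of 3 1] G_sym[OF x, of 3 2]
    by (simp add: sum_3 algebra_simps)
qed

text \<open>In an orthonormal frame, contraction with the inverse metric is a plain trace, so
  \<open>curvature_like_trace_free\<close> applies to the lowered tensor. Invertibility of the frame
  carries the vanishing back.\<close>

lemma ricci_flat_imp_flat:
  assumes x: "x \<in> S" and ric: "\<And>j k. ricci G x j k = 0"
  shows "riem G x l i j k = 0"
proof -
  obtain P :: "3 \<Rightarrow> 3 \<Rightarrow> real" where P: "\<And>i j. ginv G x i j = (\<Sum>a\<in>UNIV. P i a * P j a)"
    using frame[OF x] by blast
  define R where "R l i j k = (\<Sum>m\<in>UNIV. G x $ l $ m * riem G x m i j k)" for l i j k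
  have R1: "R l i j k = - R l j i k" for l i j k
  proof -
    have "riem G x m i j k = - riem G x m j i k" for m
      by (simp add: riem_def sum_subtractf)
    then show ?thesis by (simp add: R_def sum_negf)
  qed
  have R2: "R l i j k = - R k i j l" for l i j k
    unfolding R_def by (rule riem_metric_antisym[OF x])
  have raise: "riem G x m i j k = (\<Sum>l\<in>UNIV. ginv G x m l * R l i j k)" for m i j k
  proof -
    have "(\<Sum>l\<in>UNIV. ginv G x m l * R l i j k)
        = (\<Sum>n\<in>UNIV. (\<Sum>l\<in>UNIV. ginv G x m l * G x $ l $ n) * riem G x n i j k)"
      by (simp add: R_def sum_3 algebra_simps)
    also have "\<dots> = riem G x m i j k"
      unfolding ginv_G[OF x] by (simp add: if_distrib[of "\<lambda>a. a * _"] cong: if_cong)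
    finally show ?thesis by simp
  qed
  \<comment> \<open>The sums are nested so that the antisymmetric pair \<open>l\<close>,
    \<open>k\<close> is outermost and the pair \<open>i\<close>, \<open>j\<close> innermost, where
    \<open>antisym_contraction\<close> applies directly.\<close>
  define T where "T a b c d = (\<Sum>l\<in>UNIV. P l a * (\<Sum>k\<in>UNIV. P k d *
      (\<Sum>i\<in>UNIV. P i b * (\<Sum>j\<in>UNIV. P j c * R l i j k))))" for a b c d
  have T1: "T a b c d = - T a c b d" for a b c d
    unfolding T_def by (subst antisym_contraction[OF R1]) (simp add: sum_negf)
  have T2: "T a b c d = - T d b c a" for a b c d
    unfolding T_def
    by (rule antisym_contraction) (subst R2, simp add: sum_negf)
  have trace: "(\<Sum>a\<in>UNIV. \<Sum>l\<in>UNIV. P l a * (\<Sum>i\<in>UNIV. P i a * R l i j k)) = ricci G x j k" for j k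
  proof -
    have "ricci G x j k = (\<Sum>i\<in>UNIV. \<Sum>l\<in>UNIV. (\<Sum>a\<in>UNIV. P i a * P l a) * R l i j k)"
      unfolding ricci_def raise P ..
    then show ?thesis by (simp add: sum_3 algebra_simps)
  qed
  have T3: "(\<Sum>a\<in>UNIV. T a a c d) = 0" for c d
  proof -
    have "T a b c d = (\<Sum>k\<in>UNIV. P k d * (\<Sum>j\<in>UNIV. P j c *
        (\<Sum>l\<in>UNIV. P l a * (\<Sum>i\<in>UNIV. P i b * R l i j k))))" for a b
    proof -
      have "T a b c d = (\<Sum>k\<in>UNIV. P k d * (\<Sum>l\<in>UNIV. P l a *
          (\<Sum>i\<in>UNIV. P i b * (\<Sum>j\<in>UNIV. P j c * R l i j k))))"
        unfolding T_def by (rule contraction_swap)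
      also have "\<dots> = (\<Sum>k\<in>UNIV. P k d * (\<Sum>l\<in>UNIV. P l a *
          (\<Sum>j\<in>UNIV. P j c * (\<Sum>i\<in>UNIV. P i b * R l i j k))))"
        by (subst (3) contraction_swap) (rule refl)
      also have "\<dots> = (\<Sum>k\<in>UNIV. P k d * (\<Sum>j\<in>UNIV. P j c *
        (\<Sum>l\<in>UNIV. P l a * (\<Sum>i\<in>UNIV. P i b * R l i j k))))"
        by (subst (2) contraction_swap) (rule refl)
      finally show ?thesis .
    qed
    then have "(\<Sum>a\<in>UNIV. T a a c d) = (\<Sum>a\<in>UNIV. \<Sum>k\<in>UNIV. P k d * (\<Sum>j\<in>UNIV. P j c *
        (\<Sum>l\<in>UNIV. P l a * (\<Sum>i\<in>UNIV. P i a * R l i j k))))" by simp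
    also have "\<dots> = (\<Sum>k\<in>UNIV. P k d * (\<Sum>j\<in>UNIV. P j c *
        (\<Sum>a\<in>UNIV. \<Sum>l\<in>UNIV. P l a * (\<Sum>i\<in>UNIV. P i a * R l i j k))))"
      unfolding sum_distrib_left by (subst sum.swap, subst (2) sum.swap) (rule refl)
    also have "\<dots> = 0" unfolding trace ric by simp
    finally show ?thesis .
  qed
  have T0: "T a b c d = 0" for a b c d
    by (rule curvature_like_trace_free[of T, OF T1 T2 T3])
  \<comment> \<open>\<open>P\<close> times its transpose is the invertible inverse metric, so a
    covector that vanishes on all columns of \<open>P\<close> is zero. Used once for each of the
    four indices.\<close>
  have cancel: "X m = 0" if "\<And>a. (\<Sum>l\<in>UNIV. P l a * X l) = 0" for X m
  proof -
    have "(\<Sum>l\<in>UNIV. ginv G x n l * X l) = (\<Sum>a\<in>UNIV. P n a * (\<Sum>l\<in>UNIV. P l a * X l))" for n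
      by (simp add: P sum_3 algebra_simps)
    then have 1: "(\<Sum>l\<in>UNIV. ginv G x n l * X l) = 0" for n by (simp add: that)
    have "X m = (\<Sum>l\<in>UNIV. (\<Sum>n\<in>UNIV. G x $ m $ n * ginv G x n l) * X l)"
      unfolding G_ginv[OF x] by (simp add: if_distrib[of "\<lambda>a. a * _"] cong: if_cong)
    also have "\<dots> = (\<Sum>n\<in>UNIV. G x $ m $ n * (\<Sum>l\<in>UNIV. ginv G x n l * X l))"
      by (simp add: sum_3 algebra_simps)
    finally show ?thesis by (simp add: 1)
  qed
  have "(\<Sum>k\<in>UNIV. P k d * (\<Sum>i\<in>UNIV. P i b * (\<Sum>j\<in>UNIV. P j c * R l i j k))) = 0" for l b c d
    using cancel[of "\<lambda>l. \<Sum>k\<in>UNIV. P k d * (\<Sum>i\<in>UNIV. P i b * (\<Sum>j\<in>UNIV. P j c * R l i j k))"] T0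
    unfolding T_def by blast
  then have "(\<Sum>i\<in>UNIV. P i b * (\<Sum>j\<in>UNIV. P j c * R l i j k)) = 0" for l k b c
    using cancel[of "\<lambda>k. \<Sum>i\<in>UNIV. P i b * (\<Sum>j\<in>UNIV. P j c * R l i j k)"] by blast
  then have "(\<Sum>j\<in>UNIV. P j c * R l i j k) = 0" for l k i c
    using cancel[of "\<lambda>i. \<Sum>j\<in>UNIV. P j c * R l i j k"] by blast
  then have "R l i j k = 0" for l i j k
    using cancel[of "\<lambda>j. R l i j k"] by blast
  then show ?thesis by (simp add: raise)
qed

end

section \<open>Charts and the global argument\<close>

context
  fixes X :: "'a topology" and c :: "'a chart"
  assumes c: "is_chart X c"
begin

lemma chart_dom_subset: "chart_dom c \<subseteq> topspace X"
  using c by (simp add: is_chart_def openin_subset)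

lemma chart_im_open: "open (chart_im c)"
  using c by (simp add: is_chart_def)

lemma chart_inv_map: "p \<in> chart_dom c \<Longrightarrow> chart_inv c (chart_map c p) = p"
proof -
  have "inj_on (chart_map c) (chart_dom c)"
    using c chart_dom_subset homeomorphic_imp_injective_map[of "subtopology X (chart_dom c)"]
    by (force simp: is_chart_def inf_absorb2)
  then show "p \<in> chart_dom c \<Longrightarrow> chart_inv c (chart_map c p) = p"
    by (simp add: chart_inv_def)
qed

lemma chart_map_inv:
  "x \<in> chart_im c \<Longrightarrow> chart_inv c x \<in> chart_dom c \<and> chart_map c (chart_inv c x) = x"
  unfolding chart_im_def chart_inv_def by (simp add: f_inv_into_f inv_into_into)

lemma chart_map_in_im: "p \<in> chart_dom c \<Longrightarrow> chart_map c p \<in> chart_im c"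
  by (simp add: chart_im_def)

lemma chart_maps:
  "homeomorphic_maps (subtopology X (chart_dom c)) (top_of_set (chart_im c)) (chart_map c) (chart_inv c)"
proof -
  obtain g where g: "homeomorphic_maps (subtopology X (chart_dom c)) (top_of_set (chart_im c)) (chart_map c) g"
    using c unfolding is_chart_def homeomorphic_map_maps by blast
  have "g x = chart_inv c x" if "x \<in> chart_im c" for x
    using g that chart_map_inv[OF that] chart_dom_subset
    by (metis homeomorphic_maps_def inf_absorb2 topspace_subtopology)
  then show ?thesis
    using g by (intro homeomorphic_maps_eq[OF g]) auto
qed

lemma openin_chart_preimage:
  assumes "open U"
  shows "openin X {p \<in> chart_dom c. chart_map c p \<in> U}"
proof -
  have "continuous_map (subtopology X (chart_dom c)) euclidean (chart_map c)"
    using chart_maps continuous_map_in_subtopology homeomorphic_maps_def by blast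
  from openin_continuous_map_preimage[OF this, of U] assms
  have "openin (subtopology X (chart_dom c)) {p \<in> chart_dom c. chart_map c p \<in> U}"
    using chart_dom_subset by (simp add: inf_absorb2)
  then show ?thesis
    using c by (simp add: is_chart_def openin_open_subtopology)
qed

lemma continuous_map_chart_inv: "continuous_map (top_of_set (chart_im c)) X (chart_inv c)"
  using chart_maps continuous_map_in_subtopology homeomorphic_maps_def by blast

end

section \<open>From charts to the whole manifold\<close>

lemma smooth_fun_on_chart:
  assumes "smooth_fun_on A (topspace X) f" "c \<in> A" "is_chart X c"
  shows "smooth_on (chart_im c) (\<lambda>x. f (chart_inv c x))"
  using assms chart_dom_subset[OF assms(3)]
  by (auto simp: smooth_fun_on_def chart_im_def inf_absorb1)

lemma atlas_chart:
  assumes "smooth_atlas X A" "p \<in> topspace X"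
  obtains c where "c \<in> A" "p \<in> chart_dom c"
  using assms unfolding smooth_atlas_def by blast

lemma smooth_fun_on_continuous:
  assumes A: "smooth_atlas X A" and f: "smooth_fun_on A (topspace X) f"
  shows "continuous_map X euclideanreal f"
  unfolding continuous_map_def
proof (intro conjI allI impI)
  fix U :: "real set" assume "openin euclideanreal U"
  then have U: "open U" by simp
  have chart: "is_chart X c" if "c \<in> A" for c
    using A that by (simp add: smooth_atlas_def)
  define W where "W c = {x \<in> chart_im c. f (chart_inv c x) \<in> U}" for c
  have W: "open (W c)" if "c \<in> A" for c
  proof -
    have "continuous_on (chart_im c) (\<lambda>x. f (chart_inv c x))"
      using smooth_fun_on_chart[OF f that chart[OF that]] smooth_on_continuous by blast
    then have "open (chart_im c \<inter> (\<lambda>x. f (chart_inv c x)) -` U)"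
      using U chart_im_open[OF chart[OF that]] by (intro continuous_open_preimage)
    moreover have "chart_im c \<inter> (\<lambda>x. f (chart_inv c x)) -` U = W c" by (auto simp: W_def)
    ultimately show ?thesis by simp
  qed
  have "{p \<in> topspace X. f p \<in> U} = (\<Union>c\<in>A. {p \<in> chart_dom c. chart_map c p \<in> W c})"
  proof (intro set_eqI iffI)
    fix p assume p: "p \<in> {p \<in> topspace X. f p \<in> U}"
    then obtain c where c: "c \<in> A" "p \<in> chart_dom c"
      using atlas_chart[OF A] by blast
    then have "chart_map c p \<in> W c"
      using p chart_inv_map[OF chart[OF c(1)] c(2)] chart_map_in_im[OF chart[OF c(1)] c(2)]
      by (simp add: W_def)
    with c show "p \<in> (\<Union>c\<in>A. {p \<in> chart_dom c. chart_map c p \<in> W c})" by blast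
  next
    fix p assume "p \<in> (\<Union>c\<in>A. {p \<in> chart_dom c. chart_map c p \<in> W c})"
    then obtain c where c: "c \<in> A" "p \<in> chart_dom c" "f (chart_inv c (chart_map c p)) \<in> U"
      unfolding W_def by blast
    then show "p \<in> {p \<in> topspace X. f p \<in> U}"
      using chart_inv_map[OF chart[OF c(1)] c(2)] chart_dom_subset[OF chart[OF c(1)]] by auto
  qed
  also have "openin X \<dots>"
    by (intro openin_Union ballI) (auto intro: openin_chart_preimage[OF chart] W)
  finally show "openin X {p \<in> topspace X. f p \<in> U}" .
qed simp

lemma continuous_attains_max:
  fixes f :: "'a \<Rightarrow> real"
  assumes f: "continuous_map X euclideanreal f" and C: "compactin X C" "C \<noteq> {}"
  obtains m where "m \<in> C" "\<And>q. q \<in> C \<Longrightarrow> f q \<le> f m"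
proof -
  have "compact (f ` C)" using image_compactin[OF C(1) f] by simp
  then obtain y where "y \<in> f ` C" "\<And>t. t \<in> f ` C \<Longrightarrow> t \<le> y"
    using compact_attains_sup[of "f ` C"] C(2) by auto
  with that show thesis by (metis (no_types, lifting) imageE imageI)
qed

lemma chart_metricI:
  assumes "smooth_atlas X A" "riemannian_metric A g" "c \<in> A"
  shows "chart_metric (chart_im c) (g c)"
proof
  show "open (chart_im c)"
    using assms(1,3) chart_im_open[of X c] by (simp add: smooth_atlas_def)
qed (use assms(2,3) in \<open>auto simp: riemannian_metric_def\<close>)

text \<open>On the compact component of \<open>p\<close> the function attains a maximum. The set
  where it does so is closed by continuity and open by the strong maximum principle, hence is the
  whole component; being open, it also serves as \<open>V\<close>.\<close>

lemma compact_subharmonic_locally_constant: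
  assumes A: "smooth_atlas X A" and g: "riemannian_metric A g" and X: "compact_space X"
    and f: "smooth_fun_on A (topspace X) f"
    and sub: "\<And>c x. c \<in> A \<Longrightarrow> x \<in> chart_im c \<Longrightarrow> laplacian (g c) (\<lambda>y. f (chart_inv c y)) x \<ge> 0"
    and p: "p \<in> topspace X"
  obtains V where "openin X V" "p \<in> V" "\<And>q. q \<in> V \<Longrightarrow> f q = f p"
proof -
  have chart: "is_chart X c" if "c \<in> A" for c
    using A that by (simp add: smooth_atlas_def)
  have cont: "continuous_map X euclideanreal f"
    using smooth_fun_on_continuous[OF A f] .
  define C where "C = connected_component_of_set X p"
  have pC: "p \<in> C" using p by (simp add: C_def connected_component_of_refl)
  have "compactin X C"
    using X by (simp add: C_def closedin_compact_space closedin_connected_component_of)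
  then obtain m where m: "m \<in> C" "\<And>q. q \<in> C \<Longrightarrow> f q \<le> f m"
    using continuous_attains_max[OF cont, of C] pC by blast
  define T where "T = C \<inter> {q \<in> topspace X. f q \<in> {f m}}"
  have "closedin X T"
    unfolding T_def C_def
    by (intro closedin_Int closedin_connected_component_of closedin_continuous_map_preimage[OF cont]) simp
  moreover have "openin X T"
  proof (subst openin_subopen, intro ballI)
    fix q assume "q \<in> T"
    then have q: "q \<in> topspace X" "q \<in> C" "f q = f m" by (auto simp: T_def)
    then obtain c where c: "c \<in> A" "q \<in> chart_dom c" using atlas_chart[OF A] by blast
    interpret chart_metric "chart_im c" "g c" using chart_metricI[OF A g c(1)] .
    define x where "x = chart_map c q"
    have x: "x \<in> chart_im c" "chart_inv c x = q"
      using chart_map_in_im[OF chart[OF c(1)] c(2)] chart_inv_map[OF chart[OF c(1)] c(2)]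
      by (simp_all add: x_def)
    then obtain R where R: "R > 0" "ball x R \<subseteq> chart_im c" using S openE by blast
    define h where "h y = f (chart_inv c y)" for y
    \<comment> \<open>A coordinate ball is connected, so it stays in the component on which
      \<open>f m\<close> bounds \<open>f\<close>.\<close>
    have inC: "chart_inv c y \<in> C" if "y \<in> ball x R" for y
    proof -
      have "connectedin (top_of_set (chart_im c)) (ball x R)"
        using R by (simp add: connectedin_subtopology)
      then have "connectedin X (chart_inv c ` ball x R)"
        using connectedin_continuous_map_image[OF continuous_map_chart_inv[OF chart[OF c(1)]]] by blast
      moreover have "q \<in> chart_inv c ` ball x R" using x(2) R by force
      ultimately have "chart_inv c ` ball x R \<subseteq> connected_component_of_set X q"
        by (rule connected_component_of_maximal)
      also have "\<dots> = C"
        using q(2) connected_component_of_equiv[of X p q] by (simp add: C_def)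
      finally show ?thesis using that by blast
    qed
    \<comment> \<open>Half the radius, because the principle needs the bound on a ball twice as
      large.\<close>
    have eq: "h y = h x" if "y \<in> ball x (R / 2)" for y
    proof (rule strong_maximum_principle[where r = "R / 2"])
      show "twice_diff (chart_im c) h"
        unfolding h_def[abs_def]
        using smooth_fun_on_chart[OF f c(1) chart[OF c(1)]] S smooth_on_twice_diff by blast
      show "0 \<le> laplacian (g c) h z" if "z \<in> chart_im c" for z
        unfolding h_def[abs_def] using sub[OF c(1) that] .
      show "h z \<le> h x" if "z \<in> ball x (2 * (R / 2))" for z
        using m(2)[OF inC[of z]] that q(3) x(2) by (simp add: h_def)
    qed (use R that in auto)
    define U where "U = {p \<in> chart_dom c. chart_map c p \<in> ball x (R / 2)}"
    have "openin X U" unfolding U_def by (rule openin_chart_preimage[OF chart[OF c(1)]]) simp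
    moreover have "q \<in> U" using c R by (simp add: U_def x_def)
    moreover have "U \<subseteq> T"
    proof
      fix s assume s: "s \<in> U"
      define y where "y = chart_map c s"
      have y: "y \<in> ball x (R / 2)" "chart_inv c y = s"
        using s chart_inv_map[OF chart[OF c(1)]] by (auto simp: U_def y_def)
      then have "y \<in> ball x R" using R by auto
      from inC[OF this] eq[OF y(1)] y(2) x(2) q(3) s chart_dom_subset[OF chart[OF c(1)]]
      show "s \<in> T" by (auto simp: T_def h_def U_def)
    qed
    ultimately show "\<exists>U. openin X U \<and> q \<in> U \<and> U \<subseteq> T" by blast
  qed
  moreover have "connectedin X C" by (simp add: C_def connectedin_connected_component_of)
  moreover have "m \<in> T" using m(1) connected_component_in_topspace[of X p m] by (auto simp: T_def C_def)
  ultimately have "C \<subseteq> T"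
    using connectedin_clopen_cases[of X C T] m(1) by (auto simp: disjnt_iff)
  then have "p \<in> T" using pC by blast
  then have "f q = f p" if "q \<in> T" for q using that by (simp add: T_def)
  with \<open>openin X T\<close> \<open>p \<in> T\<close> show thesis by (rule that)
qed

theorem theorem1p2:
  fixes X :: "'a topology" and A :: "'a chart set" and g :: "'a metric_field"
    and f :: "'a \<Rightarrow> real" and E :: "'a vector_field" and \<Lambda> :: real
    and \<rho> :: "'a \<Rightarrow> real" and Q :: "'a \<Rightarrow> real"
  assumes system: "electrostatic_system X A g f E \<Lambda>"
    and compact: "compact_space X"
    and rho_smooth: "smooth_fun_on A (topspace X) \<rho>"
    and E_eq: "\<forall>c\<in>A. \<forall>x\<in>chart_im c.
        E c x = \<rho> (chart_inv c x) *\<^sub>R grad (g c) (\<lambda>y. f (chart_inv c y)) x"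
    and Q_eq: "\<forall>p\<in>topspace X. Q p = 2 * (1 - (f p)\<^sup>2 * (\<rho> p)\<^sup>2)"
    and div2_bach: "\<forall>c\<in>A. \<forall>x\<in>chart_im c. div2 (g c) (bach (g c)) x = 0"
    and Q_sign: "(\<forall>p\<in>topspace X. Q p > 0) \<or> (\<forall>p\<in>topspace X. Q p < 0)"
  shows "locally_conformally_flat X A g"
proof -
  have A: "smooth_atlas X A" and g: "riemannian_metric A g"
    and f: "smooth_fun_on A (topspace X) f" and fpos: "\<And>p. p \<in> topspace X \<Longrightarrow> f p > 0"
    using system by (auto simp: electrostatic_system_def smooth_manifold3_def)
  have chart: "is_chart X c" if "c \<in> A" for c
    using A that by (simp add: smooth_atlas_def)
  have cont: "continuous_map X euclideanreal f"
    using smooth_fun_on_continuous[OF A f] .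
  define h where "h c y = f (chart_inv c y)" for c :: "'a chart" and y
  have h_smooth: "smooth_on (chart_im c) (h c)" if "c \<in> A" for c
    unfolding h_def[abs_def] using smooth_fun_on_chart[OF f that chart[OF that]] .
  have h_pos: "h c x > 0" if "c \<in> A" "x \<in> chart_im c" for c x
    unfolding h_def using chart_map_inv[OF chart[OF that(1)] that(2)] chart_dom_subset[OF chart[OF that(1)]]
    by (intro fpos) blast
  have hess: "hess (g c) (h c) x i j = h c x * (ricci (g c) x i j - \<Lambda> * g c x $ i $ j
        + 2 * dual_form (g c) (E c) x i * dual_form (g c) (E c) x j
        - normsq (g c) (E c) x * g c x $ i $ j)"
    and lap: "laplacian (g c) (h c) x = (normsq (g c) (E c) x - \<Lambda>) * h c x"
    if "c \<in> A" "x \<in> chart_im c" for c x i j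
    using system that unfolding electrostatic_system_def Let_def h_def[abs_def] by blast+
  have E0: "E c x = 0" if "c \<in> A" "x \<in> chart_im c" "\<And>j. pd j (h c) x = 0" for c x
  proof -
    have "grad (g c) (h c) x = 0" using that(3) by (simp add: grad_def vec_eq_iff)
    then show ?thesis using E_eq that(1,2) by (simp add: h_def[abs_def])
  qed
  \<comment> \<open>An empty manifold has no extremum and leaves \<Lambda> arbitrary; later the
    condition is discharged by the chart point under consideration.\<close>
  have "\<Lambda> = 0" if "topspace X \<noteq> {}"
  proof -
    have X: "compactin X (topspace X)" using compact by (simp add: compact_space_def)
    \<comment> \<open>The factor \<open>s\<close> treats maxima (\<open>s = 1\<close>) and minima
      (\<open>s = -1\<close>) alike. As \<open>E\<close> vanishes at the extremum, the Laplacian of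
      \<open>s * f\<close> there is \<open>- s * \<Lambda> * f\<close>, and it is
      nonpositive.\<close>
    have ext: "s * \<Lambda> \<ge> 0" if m: "m \<in> topspace X" "\<And>q. q \<in> topspace X \<Longrightarrow> s * f q \<le> s * f m" 
      and s: "s \<noteq> 0" for m s
    proof -
      obtain c where c: "c \<in> A" "m \<in> chart_dom c" using atlas_chart[OF A m(1)] by blast
      interpret chart_metric "chart_im c" "g c" using chart_metricI[OF A g c(1)] .
      define x where "x = chart_map c m"
      have x: "x \<in> chart_im c" "chart_inv c x = m"
        using chart_map_in_im[OF chart[OF c(1)] c(2)] chart_inv_map[OF chart[OF c(1)] c(2)]
        by (simp_all add: x_def)
      then obtain R where R: "R > 0" "ball x R \<subseteq> chart_im c" using S openE by blast
      \<comment> \<open>The summand 0 gives \<open>w\<close> the form treated by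
        \<open>laplacian_add_cmult\<close>.\<close>
      define w where "w y = 0 + s * h c y" for y
      have hd: "twice_diff (chart_im c) (h c)" and z: "twice_diff (chart_im c) (\<lambda>x. 0)"
        using S h_smooth[OF c(1)] smooth_on_const smooth_on_twice_diff by blast+
      note w = laplacian_add_cmult[OF z hd, where c = s, folded w_def[abs_def]]
      have max: "w y \<le> w x" if "y \<in> ball x R" for y
      proof -
        have "y \<in> chart_im c" using that R by blast
        then have "chart_inv c y \<in> topspace X"
          using chart_map_inv[OF chart[OF c(1)]] chart_dom_subset[OF chart[OF c(1)]] by blast
        from m(2)[OF this] show ?thesis by (simp add: w_def h_def x(2))
      qed
      have "s * pd j (h c) x = 0" for j
        using max_gradient_hessian(1)[OF w(1) R max, of j] hd x(1)
        by (simp add: w_def[abs_def] pd_cmult twice_diff_def)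
      then have "E c x = 0" using E0[OF c(1) x(1)] s by simp
      then have "normsq (g c) (E c) x = 0" by (simp add: normsq_def)
      moreover have "laplacian (g c) w x \<le> 0" by (rule laplacian_max[OF w(1) R max])
      moreover have "laplacian (g c) (\<lambda>x. 0) x = 0"
      proof -
        have "pd j (\<lambda>x. 0) = (\<lambda>x. 0)" for j by (rule ext) simp
        then show ?thesis by (simp add: laplacian_def hess_def)
      qed
      ultimately have "(s * \<Lambda>) * h c x \<ge> 0"
        using w(2)[OF x(1)] lap[OF c(1) x(1)] by (simp add: mult_ac)
      with h_pos[OF c(1) x(1)] show ?thesis by (simp add: zero_le_mult_iff)
    qed
    obtain m where "m \<in> topspace X" "\<And>q. q \<in> topspace X \<Longrightarrow> f q \<le> f m"
      using continuous_attains_max[OF cont X \<open>topspace X \<noteq> {}\<close>] by blast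
    then have "\<Lambda> \<ge> 0" using ext[of m 1] by simp
    moreover obtain n where "n \<in> topspace X" "\<And>q. q \<in> topspace X \<Longrightarrow> - f q \<le> - f n"
      using continuous_attains_max[OF continuous_map_minus[OF cont] X \<open>topspace X \<noteq> {}\<close>] by blast
    then have "\<Lambda> \<le> 0" using ext[of n "-1"] by simp
    ultimately show "\<Lambda> = 0" by simp
  qed
  then have \<Lambda>: "\<Lambda> = 0" if "c \<in> A" "x \<in> chart_im c" for c x
    using chart_map_inv[OF chart[OF that(1)] that(2)] chart_dom_subset[OF chart[OF that(1)]] by blast
  have sub: "laplacian (g c) (\<lambda>y. f (chart_inv c y)) x \<ge> 0" if "c \<in> A" "x \<in> chart_im c" for c x
  proof -
    interpret chart_metric "chart_im c" "g c" using chart_metricI[OF A g that(1)] .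
    show ?thesis
      using lap[OF that] normsq_nonneg[OF that(2)] h_pos[OF that] \<Lambda>[OF that]
      by (simp add: h_def[abs_def])
  qed
  have flat: "riem (g c) x l i j k = 0" if cx: "c \<in> A" "x \<in> chart_im c" for c x l i j k
  proof -
    interpret chart_metric "chart_im c" "g c" using chart_metricI[OF A g cx(1)] .
    have "chart_inv c x \<in> topspace X"
      using chart_map_inv[OF chart[OF cx(1)] cx(2)] chart_dom_subset[OF chart[OF cx(1)]] by blast
    then obtain V where V: "openin X V" "chart_inv c x \<in> V" "\<And>q. q \<in> V \<Longrightarrow> f q = f (chart_inv c x)"
      using compact_subharmonic_locally_constant[OF A g compact f sub] by blast
    \<comment> \<open>Constancy on a neighbourhood, not just a critical point, is what makes the
      second derivatives vanish too.\<close>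
    define U where "U = {y \<in> chart_im c. chart_inv c y \<in> V}"
    have "openin (top_of_set (chart_im c)) U"
      using openin_continuous_map_preimage[OF continuous_map_chart_inv[OF chart[OF cx(1)]] V(1)]
      by (simp add: U_def)
    then have U: "open U" using S openin_open_trans by blast
    have xU: "x \<in> U" using cx V by (simp add: U_def)
    have hd: "h c differentiable (at y)" "pd j (h c) differentiable (at y)" if "y \<in> U" for y j
      using smooth_on_twice_diff[OF h_smooth[OF cx(1)] S] that by (auto simp: twice_diff_def U_def)
    have d1: "pd j (h c) y = 0" if "y \<in> U" for y j
      using pd_cong_open[OF U that, of "h c" "\<lambda>_. f (chart_inv c x)"] V(3) hd that
      by (simp add: U_def h_def)
    have d2: "pd i (pd j (h c)) x = 0" for i j
      using pd_cong_open[OF U xU, of "pd j (h c)" "\<lambda>_. 0"] d1 hd xU by simp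
    have "E c x = 0" using E0[OF cx] d1[OF xU] by blast
    moreover have "hess (g c) (h c) x i j = 0" for i j by (simp add: hess_def d1[OF xU] d2)
    ultimately have "ricci (g c) x i j = 0" for i j
      using hess[OF cx, of i j] h_pos[OF cx] \<Lambda>[OF cx] by (simp add: normsq_def dual_form_def)
    then show ?thesis by (rule ricci_flat_imp_flat[OF cx(2)])
  qed
  \<comment> \<open>The metric itself is flat, so the exponent 0 on the whole space serves every
    point.\<close>
  have "conformal_metric (\<lambda>_. 0) g = g" by (simp add: conformal_metric_def)
  moreover have "flat_on A (topspace X) g"
    unfolding flat_on_def using flat by (auto simp: chart_im_def)
  moreover have "smooth_fun_on A (topspace X) (\<lambda>_. 0)"
    by (simp add: smooth_fun_on_def smooth_on_const)
  ultimately show ?thesis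
    unfolding locally_conformally_flat_def
    by (intro ballI exI[of _ "topspace X"] exI[of _ "\<lambda>_. 0"]) simp
qed

end
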